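(* Let $L$ be a flat linear transport of class $C^1$ over a real differentiable manifold $M$ (of class at least $C^2$), and let $\nabla^L$ be the linear connection generated by $L$. The vanishing of the torsion ${}^{L}T$ of $\nabla^L$ is a necessary and sufficient condition for the existence, in a neighborhood of every point of $M$, of a field of holonomic bases in which the matrix $\mathbf{H}(y,x)$ describing $L$ is constant (independent of $x$ and $y$).
   Context: $T^{p,q}_x(M)$ is the space of tensors of type $(p,q)$ at $x$. A flat linear transport (of tensors) over $M$ is a map $L:(x,y)\mapsto L_{x\to y}$, $x,y\in M$, where $L_{x\to y}$ maps tensors at $x$ to tensors at $y$, such that for all $x,y,z\in M$ and all types: (i) $L_{x\to y}(T^{p,q}_x(M))\subseteq T^{p,q}_y(M)$; (ii) $L_{x\to y}$ is linear on each $T^{p,q}_x(M)$; (iii) $L_{x\to y}(A_1\otimes A_2)=(L_{x\to y}A_1)\otimes(L_{x\to y}A_2)$; (iv) $L_{x\to y}\circ C=C\circ L_{x\to y}$ for every contraction operator $C$; (v) $L_{y\to z}\circ L_{x\to y}=L_{x\to z}$; (vi) $L_{x\to x}=\mathrm{id}$. In a field of bases $\{E_i\}$ the matrix $\mathbf{H}(y,x)=[H^{i}{}_{j}(y,x)]$ describing $L$ is defined by $L_{x\to y}(E_j(x))=H^{i}{}_{j}(y,x)E_i(y)$; $L$ is of class $C^1$ if in local coordinate bases these functions are $C^1$ in $(y,x)$. The linear connection generated by $L$ is $\nabla^L:V\mapsto\nabla^L_V$, $(\nabla^L_VS)(x):=\lim_{\varepsilon\to0}\frac1\varepsilon\bigl(L_{x_\varepsilon\to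 x}S(x_\varepsilon)-S(x)\bigr)$ for vector fields $V$ and $C^1$ tensor fields $S$, where in local coordinates around $x$ the point $x_\varepsilon$ has coordinates $x^i+\varepsilon V^i|_x$. The torsion of a linear connection $\nabla$ is $T(A,B):=\nabla_AB-\nabla_BA-[A,B]$ for vector fields $A,B$. A local field of bases is holonomic if it has the form $\{\partial/\partial x^i\}$ for some local coordinates $\{x^i\}$ of $M$. *)

theory Defs
  imports "HOL-Analysis.Analysis"
begin

section \<open>Maps of class C1 and C2 on open subsets of Euclidean spaces\<close>

definition C1_on :: "'a::euclidean_space set \<Rightarrow> ('a \<Rightarrow> 'b::real_normed_vector) \<Rightarrow> bool" where
  "C1_on S f \<longleftrightarrow>
     (\<exists>f' :: 'a \<Rightarrow> 'a \<Rightarrow>\<^sub>L 'b.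
        (\<forall>u\<in>S. (f has_derivative blinfun_apply (f' u)) (at u)) \<and> continuous_on S f')"

definition C2_on :: "'a::euclidean_space set \<Rightarrow> ('a \<Rightarrow> 'b::real_normed_vector) \<Rightarrow> bool" where
  "C2_on S f \<longleftrightarrow>
     (\<exists>f' :: 'a \<Rightarrow> 'a \<Rightarrow>\<^sub>L 'b.
        (\<forall>u\<in>S. (f has_derivative blinfun_apply (f' u)) (at u)) \<and> C1_on S f')"

section \<open>Manifolds of class at least C2 and their local coordinates\<close>

text \<open>A chart is a pair of its domain and its coordinate map; the values of the coordinate map
  outside of the domain are irrelevant.\<close>

type_synonym ('m, 'n) chart = "'m set \<times> ('m \<Rightarrow> real ^ 'n)"

abbreviation chart_dom :: "('m, 'n) chart \<Rightarrow> 'm set" where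
  "chart_dom c \<equiv> fst c"

abbreviation chart_map :: "('m, 'n) chart \<Rightarrow> 'm \<Rightarrow> real ^ 'n" where
  "chart_map c \<equiv> snd c"

abbreviation chart_range :: "('m, 'n) chart \<Rightarrow> (real ^ 'n) set" where
  "chart_range c \<equiv> chart_map c ` chart_dom c"

definition chart_inv :: "('m, 'n) chart \<Rightarrow> real ^ 'n \<Rightarrow> 'm" where
  "chart_inv c = inv_into (chart_dom c) (chart_map c)"

definition is_chart :: "'m topology \<Rightarrow> ('m, 'n::finite) chart \<Rightarrow> bool" where
  "is_chart M c \<longleftrightarrow>
     openin M (chart_dom c) \<and> open (chart_range c) \<and>
     homeomorphic_map (subtopology M (chart_dom c)) (top_of_set (chart_range c)) (chart_map c)"

definition C2_compatible :: "('m, 'n::finite) chart \<Rightarrow> ('m, 'n) chart \<Rightarrow> bool" where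
  "C2_compatible c d \<longleftrightarrow>
     C2_on (chart_map c ` (chart_dom c \<inter> chart_dom d)) (chart_map d \<circ> chart_inv c) \<and>
     C2_on (chart_map d ` (chart_dom c \<inter> chart_dom d)) (chart_map c \<circ> chart_inv d)"

text \<open>The atlas is not required to be maximal, so an atlas whose transition maps are of a class
  higher than C2 (for instance the structure of a smooth manifold) is admitted as it is.
  The local coordinates of the manifold are all the charts that are C2-compatible with the atlas:
  for transports that are merely of class C1, coordinates with the properties wanted below are in
  general only of class C2, even if the manifold is smooth.\<close>

definition C2_manifold :: "'m topology \<Rightarrow> ('m, 'n::finite) chart set \<Rightarrow> bool" where
  "C2_manifold M \<A> \<longleftrightarrow>
     Hausdorff_space M \<and>
     (\<forall>c\<in>\<A>. is_chart M c) \<and>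
     (\<Union>c\<in>\<A>. chart_dom c) = topspace M \<and>
     (\<forall>c\<in>\<A>. \<forall>d\<in>\<A>. C2_compatible c d)"

definition local_coords :: "'m topology \<Rightarrow> ('m, 'n::finite) chart set \<Rightarrow> ('m, 'n) chart set" where
  "local_coords M \<A> = {c. is_chart M c \<and> (\<forall>d\<in>\<A>. C2_compatible c d)}"

definition coords_at ::
    "'m topology \<Rightarrow> ('m, 'n::finite) chart set \<Rightarrow> 'm \<Rightarrow> ('m, 'n) chart set" where
  "coords_at M \<A> x = {c \<in> local_coords M \<A>. x \<in> chart_dom c}"

text \<open>The entry in row i and column k of \<open>jacobian c d x\<close> is the derivative at x of the
  i-th coordinate of d with respect to the k-th coordinate of c.\<close>

definition jacobian :: "('m, 'n::finite) chart \<Rightarrow> ('m, 'n) chart \<Rightarrow> 'm \<Rightarrow> real ^ 'n ^ 'n" where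
  "jacobian c d x =
     matrix (frechet_derivative (chart_map d \<circ> chart_inv c) (at (chart_map c x)))"

section \<open>Tensors\<close>

text \<open>A tensor of type (p, q) at x is given by its components in all local coordinates around x,
  which are related by the tensor transformation law.  The first list holds the p contravariant
  (upper) indices, the second one the q covariant (lower) indices.  The components are set to 0
  where they make no sense, so that equality of tensors is equality of functions.
  Tangent vectors are the tensors of type (1, 0).\<close>

type_synonym ('m, 'n) tensor = "('m, 'n) chart \<Rightarrow> 'n list \<Rightarrow> 'n list \<Rightarrow> real"

definition tensors ::
    "'m topology \<Rightarrow> ('m, 'n::finite) chart set \<Rightarrow> nat \<Rightarrow> nat \<Rightarrow> 'm \<Rightarrow> ('m, 'n) tensor set" where
  "tensors M \<A> p q x =
     {T. (\<forall>c ks ls. \<not> (c \<in> coords_at M \<A> x \<and> length ks = p \<and> length ls = q) \<longrightarrow>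
             T c ks ls = 0) \<and>
         (\<forall>c\<in>coords_at M \<A> x. \<forall>d\<in>coords_at M \<A> x.
            \<forall>ks ls. length ks = p \<longrightarrow> length ls = q \<longrightarrow>
              T d ks ls =
                (\<Sum>us | length us = p. \<Sum>vs | length vs = q.
                   (\<Prod>a<p. jacobian c d x $ (ks ! a) $ (us ! a)) *
                   (\<Prod>b<q. jacobian d c x $ (vs ! b) $ (ls ! b)) * T c us vs))}"

definition tensor_zero :: "('m, 'n) tensor" where
  "tensor_zero = (\<lambda>c ks ls. 0)"

definition tensor_add :: "('m, 'n) tensor \<Rightarrow> ('m, 'n) tensor \<Rightarrow> ('m, 'n) tensor" where
  "tensor_add S T = (\<lambda>c ks ls. S c ks ls + T c ks ls)"

definition tensor_diff :: "('m, 'n) tensor \<Rightarrow> ('m, 'n) tensor \<Rightarrow> ('m, 'n) tensor" where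
  "tensor_diff S T = (\<lambda>c ks ls. S c ks ls - T c ks ls)"

definition tensor_scale :: "real \<Rightarrow> ('m, 'n) tensor \<Rightarrow> ('m, 'n) tensor" where
  "tensor_scale r T = (\<lambda>c ks ls. r * T c ks ls)"

definition tensor_sum :: "('i \<Rightarrow> ('m, 'n) tensor) \<Rightarrow> 'i set \<Rightarrow> ('m, 'n) tensor" where
  "tensor_sum T I = (\<lambda>c ks ls. \<Sum>i\<in>I. T i c ks ls)"

text \<open>Here (p, q) is the type of the first factor.\<close>

definition tensor_prod ::
    "nat \<Rightarrow> nat \<Rightarrow> ('m, 'n) tensor \<Rightarrow> ('m, 'n) tensor \<Rightarrow> ('m, 'n) tensor" where
  "tensor_prod p q S T =
     (\<lambda>c ks ls. S c (take p ks) (take q ls) * T c (drop p ks) (drop q ls))"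

text \<open>Contraction of the a-th upper with the b-th lower index, counted from 0.\<close>

definition contraction :: "nat \<Rightarrow> nat \<Rightarrow> ('m, 'n::finite) tensor \<Rightarrow> ('m, 'n) tensor" where
  "contraction a b T =
     (\<lambda>c ks ls. \<Sum>k\<in>UNIV. T c (take a ks @ k # drop a ks) (take b ls @ k # drop b ls))"

type_synonym ('m, 'n) tensor_field = "'m \<Rightarrow> ('m, 'n) tensor"

definition C1_tensor_field ::
    "'m topology \<Rightarrow> ('m, 'n::finite) chart set \<Rightarrow> nat \<Rightarrow> nat \<Rightarrow> ('m, 'n) tensor_field \<Rightarrow> bool" where
  "C1_tensor_field M \<A> p q S \<longleftrightarrow>
     (\<forall>x\<in>topspace M. S x \<in> tensors M \<A> p q x) \<and>
     (\<forall>c\<in>local_coords M \<A>. \<forall>ks ls.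
        C1_on (chart_range c) (\<lambda>u. S (chart_inv c u) c ks ls))"

abbreviation C1_vector_field ::
    "'m topology \<Rightarrow> ('m, 'n::finite) chart set \<Rightarrow> ('m, 'n) tensor_field \<Rightarrow> bool" where
  "C1_vector_field M \<A> V \<equiv> C1_tensor_field M \<A> 1 0 V"

definition vector_components ::
    "('m, 'n::finite) tensor_field \<Rightarrow> ('m, 'n) chart \<Rightarrow> 'm \<Rightarrow> real ^ 'n" where
  "vector_components V c x = (\<chi> i. V x c [i] [])"

section \<open>Fields of bases\<close>

text \<open>The tangent vector at x to the j-th coordinate line of c; its i-th component in the local
  coordinates d is the derivative of the i-th coordinate of d with respect to the j-th
  coordinate of c.\<close>

definition coord_basis ::
    "'m topology \<Rightarrow> ('m, 'n::finite) chart set \<Rightarrow> ('m, 'n) chart \<Rightarrow> 'n \<Rightarrow> ('m, 'n) tensor_field" where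
  "coord_basis M \<A> c j x =
     (\<lambda>d ks ls. if d \<in> coords_at M \<A> x \<and> length ks = 1 \<and> ls = []
                 then jacobian c d x $ hd ks $ j else 0)"

definition holonomic_basis_field ::
    "'m topology \<Rightarrow> ('m, 'n::finite) chart set \<Rightarrow> 'm set \<Rightarrow> ('n \<Rightarrow> ('m, 'n) tensor_field) \<Rightarrow> bool" where
  "holonomic_basis_field M \<A> U E \<longleftrightarrow>
     (\<exists>c\<in>local_coords M \<A>. U \<subseteq> chart_dom c \<and> (\<forall>x\<in>U. \<forall>j. E j x = coord_basis M \<A> c j x))"

section \<open>Flat linear transports\<close>

text \<open>\<open>L x y\<close> is the transport from the point x to the point y.\<close>

type_synonym ('m, 'n) transport = "'m \<Rightarrow> 'm \<Rightarrow> ('m, 'n) tensor \<Rightarrow> ('m, 'n) tensor"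

definition flat_linear_transport ::
    "'m topology \<Rightarrow> ('m, 'n::finite) chart set \<Rightarrow> ('m, 'n) transport \<Rightarrow> bool" where
  "flat_linear_transport M \<A> L \<longleftrightarrow>
     (\<forall>x\<in>topspace M. \<forall>y\<in>topspace M. \<forall>p q.
        L x y ` tensors M \<A> p q x \<subseteq> tensors M \<A> p q y) \<and>
     (\<forall>x\<in>topspace M. \<forall>y\<in>topspace M. \<forall>p q.
        \<forall>S\<in>tensors M \<A> p q x. \<forall>T\<in>tensors M \<A> p q x. \<forall>r s.
          L x y (tensor_add (tensor_scale r S) (tensor_scale s T)) =
            tensor_add (tensor_scale r (L x y S)) (tensor_scale s (L x y T))) \<and>
     (\<forall>x\<in>topspace M. \<forall>y\<in>topspace M. \<forall>p q p' q'.
        \<forall>S\<in>tensors M \<A> p q x. \<forall>T\<in>tensors M \<A> p' q' x.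
          L x y (tensor_prod p q S T) = tensor_prod p q (L x y S) (L x y T)) \<and>
     (\<forall>x\<in>topspace M. \<forall>y\<in>topspace M. \<forall>p q. \<forall>a<p. \<forall>b<q. \<forall>T\<in>tensors M \<A> p q x.
        L x y (contraction a b T) = contraction a b (L x y T)) \<and>
     (\<forall>x\<in>topspace M. \<forall>y\<in>topspace M. \<forall>z\<in>topspace M. \<forall>p q. \<forall>T\<in>tensors M \<A> p q x.
        L y z (L x y T) = L x z T) \<and>
     (\<forall>x\<in>topspace M. \<forall>p q. \<forall>T\<in>tensors M \<A> p q x. L x x T = T)"

text \<open>H is the matrix describing L in the field of bases E over U.\<close>

definition transport_matrix ::
    "('m, 'n::finite) transport \<Rightarrow> 'm set \<Rightarrow> ('n \<Rightarrow> ('m, 'n) tensor_field) \<Rightarrow>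
     ('m \<Rightarrow> 'm \<Rightarrow> real ^ 'n ^ 'n) \<Rightarrow> bool" where
  "transport_matrix L U E H \<longleftrightarrow>
     (\<forall>x\<in>U. \<forall>y\<in>U. \<forall>j.
        L x y (E j x) = tensor_sum (\<lambda>i. tensor_scale (H y x $ i $ j) (E i y)) UNIV)"

definition C1_transport ::
    "'m topology \<Rightarrow> ('m, 'n::finite) chart set \<Rightarrow> ('m, 'n) transport \<Rightarrow> bool" where
  "C1_transport M \<A> L \<longleftrightarrow>
     (\<forall>c\<in>local_coords M \<A>. \<exists>H.
        transport_matrix L (chart_dom c) (coord_basis M \<A> c) H \<and>
        C1_on (chart_range c \<times> chart_range c) (\<lambda>(v, u). H (chart_inv c v) (chart_inv c u)))"

section \<open>The generated connection and its torsion\<close>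

type_synonym ('m, 'n) connection =
  "('m, 'n) tensor_field \<Rightarrow> ('m, 'n) tensor_field \<Rightarrow> ('m, 'n) tensor_field"

definition displaced_point ::
    "('m, 'n::finite) chart \<Rightarrow> ('m, 'n) tensor_field \<Rightarrow> 'm \<Rightarrow> real \<Rightarrow> 'm" where
  "displaced_point c V x \<epsilon> = chart_inv c (chart_map c x + \<epsilon> *\<^sub>R vector_components V c x)"

text \<open>The limit of tensors at x is taken componentwise, the components in the local coordinates c
  being computed with the displaced point that belongs to c.  For transports and tensor fields
  of class C1 the limit does not depend on the coordinates in which the displacement is made.\<close>

definition generated_connection ::
    "'m topology \<Rightarrow> ('m, 'n::finite) chart set \<Rightarrow> ('m, 'n) transport \<Rightarrow> ('m, 'n) connection" where
  "generated_connection M \<A> L V S x =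
     (\<lambda>c ks ls. if c \<in> coords_at M \<A> x
        then Lim (at 0) (\<lambda>\<epsilon>.
               tensor_scale (1 / \<epsilon>)
                 (tensor_diff (L (displaced_point c V x \<epsilon>) x (S (displaced_point c V x \<epsilon>))) (S x))
                 c ks ls)
        else 0)"

text \<open>The components of the Lie bracket of A and B in local coordinates are \<open>A(B\<^sup>i) - B(A\<^sup>i)\<close>.\<close>

definition lie_bracket ::
    "'m topology \<Rightarrow> ('m, 'n::finite) chart set \<Rightarrow>
     ('m, 'n) tensor_field \<Rightarrow> ('m, 'n) tensor_field \<Rightarrow> ('m, 'n) tensor_field" where
  "lie_bracket M \<A> A B x =
     (\<lambda>c ks ls. if c \<in> coords_at M \<A> x \<and> length ks = 1 \<and> ls = []
        then frechet_derivative (\<lambda>u. vector_components B c (chart_inv c u)) (at (chart_map c x))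
               (vector_components A c x) $ hd ks
           - frechet_derivative (\<lambda>u. vector_components A c (chart_inv c u)) (at (chart_map c x))
               (vector_components B c x) $ hd ks
        else 0)"

definition torsion ::
    "'m topology \<Rightarrow> ('m, 'n::finite) chart set \<Rightarrow> ('m, 'n) connection \<Rightarrow>
     ('m, 'n) tensor_field \<Rightarrow> ('m, 'n) tensor_field \<Rightarrow> ('m, 'n) tensor_field" where
  "torsion M \<A> D A B x =
     tensor_diff (tensor_diff (D A B x) (D B A x)) (lie_bracket M \<A> A B x)"

definition torsion_vanishes ::
    "'m topology \<Rightarrow> ('m, 'n::finite) chart set \<Rightarrow> ('m, 'n) connection \<Rightarrow> bool" where
  "torsion_vanishes M \<A> D \<longleftrightarrow>
     (\<forall>A B. C1_vector_field M \<A> A \<longrightarrow> C1_vector_field M \<A> B \<longrightarrow>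
        (\<forall>x\<in>topspace M. torsion M \<A> D A B x = tensor_zero))"

end

theory Submission
  imports Defs
begin

text \<open>Fix a chart c and let K(y, x) be the matrix of L in its coordinate basis.  Flatness means that
  K(z, y) K(y, x) = K(z, x) and K(x, x) = 1.  With \<open>\<Gamma>\<^sub>x\<close> the derivative at w = x of K(x, w), the
  generated connection is \<open>\<nabla>\<^sub>V S = S' V + \<Gamma>\<^sub>x(V) S\<close> in components, and its torsion is
  \<open>\<Gamma>\<^sub>x(A) B - \<Gamma>\<^sub>x(B) A\<close>.  Only the values of A and B at x occur here, and any two vectors at x extend to
  global vector fields of class C1 by transporting them with L.  Hence the torsion vanishes if and
  only if \<open>\<Gamma>\<^sub>x(a) b\<close> is symmetric in a and b in every chart and at every point
  (\<open>torsion_vanishes_iff\<close>).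

  Suppose that it is symmetric, and fix a point z of the chart.  The rows of K(z, w), as
  functions of w, are 1-forms of class C1.  Their derivative at x is \<open>K(z, x) \<Gamma>\<^sub>x\<close>, so symmetry says that
  they are closed.  On a ball they have a primitive \<open>\<phi>\<close> by the Poincare lemma.  Its
  derivative is invertible with inverse K(w, z), so \<open>\<phi>\<close> is a local diffeomorphism, and of class C2
  together with its inverse.  The coordinate basis of the new coordinates \<open>\<phi> \<circ> c\<close> consists of
  the columns of K(w, z), which are parallel; in these coordinates the matrix of L is the
  identity (\<open>symmetric_imp_parallel_chart\<close>).

  Conversely, if the matrix of L is constant in the coordinate basis of a chart d, it is the
  identity and this basis is parallel.  In any chart c then K(x, y) = J(x) f'(y), where f is the
  transition map from c to d and J(x) is the inverse of f'(x).  So \<open>\<Gamma>\<^sub>x(a) b\<close> is J(x) applied to the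
  second derivative of f at x, which is symmetric (\<open>constant_matrix_imp_symmetric\<close>).\<close>

section \<open>Maps of class C1 and C2\<close>

lemma C1_onE:
  assumes "C1_on S f"
  obtains f' where "\<And>u. u \<in> S \<Longrightarrow> (f has_derivative blinfun_apply (f' u)) (at u)"
    and "continuous_on S f'"
  using assms unfolding C1_on_def by blast

lemma C1_on_subset:
  assumes "C1_on S f" "T \<subseteq> S"
  shows "C1_on T f"
proof -
  obtain f' where "\<And>u. u \<in> S \<Longrightarrow> (f has_derivative blinfun_apply (f' u)) (at u)"
    and "continuous_on S f'"
    using assms(1) by (rule C1_onE) blast
  then show ?thesis
    using assms(2) continuous_on_subset unfolding C1_on_def by (intro exI[of _ f']) blast
qed

lemma C1_on_imp_continuous_on: "C1_on S f \<Longrightarrow> continuous_on S f"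
  by (erule C1_onE) (meson continuous_at_imp_continuous_on has_derivative_continuous)

lemma C1_on_imp_differentiable: "C1_on S f \<Longrightarrow> u \<in> S \<Longrightarrow> f differentiable (at u)"
  unfolding C1_on_def differentiable_def by blast

lemma C1_on_cong_open:
  assumes "C1_on S f" "open W" "S \<subseteq> W" "\<And>u. u \<in> W \<Longrightarrow> f u = g u"
  shows "C1_on S g"
proof -
  obtain f' where f': "\<And>u. u \<in> S \<Longrightarrow> (f has_derivative blinfun_apply (f' u)) (at u)"
    and "continuous_on S f'"
    using assms(1) by (rule C1_onE) blast
  moreover have "(g has_derivative blinfun_apply (f' u)) (at u)" if "u \<in> S" for u
    using has_derivative_transform_within_open[OF f'[OF that] assms(2)] assms(3,4) that by auto
  ultimately show ?thesis unfolding C1_on_def by blast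
qed

lemma derivative_blinfun_unique:
  assumes "(f has_derivative blinfun_apply A) (at u)" "(f has_derivative blinfun_apply B) (at u)"
  shows "A = B"
  using has_derivative_unique[OF assms] by (simp add: blinfun_apply_inject)

text \<open>Derivatives at a point are unique, so the derivatives given near each point agree with one
  function on S; that function is continuous because continuity is local.\<close>

lemma C1_on_local:
  assumes "\<And>u. u \<in> S \<Longrightarrow> \<exists>N. open N \<and> u \<in> N \<and> C1_on N f"
  shows "C1_on S f"
proof -
  define f' where "f' u = (SOME D. (f has_derivative blinfun_apply D) (at u))" for u
  have "(f has_derivative blinfun_apply (f' u)) (at u) \<and> isCont f' u" if u: "u \<in> S" for u
  proof -
    obtain N where N: "open N" "u \<in> N" "C1_on N f"
      using assms[OF u] by blast
    obtain D where D: "\<And>v. v \<in> N \<Longrightarrow> (f has_derivative blinfun_apply (D v)) (at v)"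
      and contD: "continuous_on N D"
      using N(3) by (rule C1_onE) blast
    have eq: "D v = f' v" if "v \<in> N" for v
      using D[OF that] someI[of "\<lambda>B. (f has_derivative blinfun_apply B) (at v)" "D v"]
      unfolding f'_def by (meson derivative_blinfun_unique)
    have "continuous_on N f'"
      using contD eq by (simp cong: continuous_on_cong)
    then show ?thesis
      using N(1,2) D[OF N(2)] eq[OF N(2)] by (simp add: continuous_on_eq_continuous_at)
  qed
  then show ?thesis
    unfolding C1_on_def by (meson continuous_at_imp_continuous_on)
qed

lemma C1_on_compose:
  assumes f: "C1_on S f" and g: "C1_on T g" and sub: "f ` S \<subseteq> T"
  shows "C1_on S (g \<circ> f)"
proof -
  obtain f' where f': "\<And>u. u \<in> S \<Longrightarrow> (f has_derivative blinfun_apply (f' u)) (at u)"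
    and contf: "continuous_on S f'"
    using f by (rule C1_onE) blast
  obtain g' where g': "\<And>u. u \<in> T \<Longrightarrow> (g has_derivative blinfun_apply (g' u)) (at u)"
    and contg: "continuous_on T g'"
    using g by (rule C1_onE) blast
  let ?h = "\<lambda>u. g' (f u) o\<^sub>L f' u"
  have "((g \<circ> f) has_derivative blinfun_apply (?h u)) (at u)" if "u \<in> S" for u
  proof -
    have "f u \<in> T" using sub that by blast
    then show ?thesis
      using diff_chain_at[OF f'[OF that] g'] by (simp add: blinfun_compose.rep_eq)
  qed
  moreover have "continuous_on S ?h"
    using continuous_on_compose2[OF contg C1_on_imp_continuous_on[OF f] sub] contf
    by (rule bounded_bilinear.continuous_on[OF bounded_bilinear_blinfun_compose])
  ultimately show ?thesis unfolding C1_on_def by (intro exI[of _ ?h]) blast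
qed

lemma C1_on_bilinear:
  assumes "bounded_bilinear B" and f: "C1_on S f" and g: "C1_on S g"
  shows "C1_on S (\<lambda>u. B (f u) (g u))"
proof -
  interpret bounded_bilinear B by fact
  obtain f' where f': "\<And>u. u \<in> S \<Longrightarrow> (f has_derivative blinfun_apply (f' u)) (at u)"
    and contf: "continuous_on S f'"
    using f by (rule C1_onE) blast
  obtain g' where g': "\<And>u. u \<in> S \<Longrightarrow> (g has_derivative blinfun_apply (g' u)) (at u)"
    and contg: "continuous_on S g'"
    using g by (rule C1_onE) blast
  let ?h = "\<lambda>u. (prod_right (f u) o\<^sub>L g' u) + (prod_left (g u) o\<^sub>L f' u)"
  have "((\<lambda>u. B (f u) (g u)) has_derivative blinfun_apply (?h u)) (at u)" if "u \<in> S" for u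
    using FDERIV[OF f'[OF that] g'[OF that]]
    by (rule has_derivative_eq_rhs) (simp add: blinfun.add_left fun_eq_iff)
  moreover have "continuous_on S ?h"
    by (intro continuous_intros contf contg
        bounded_linear.continuous_on[OF bounded_linear_prod_right]
        bounded_linear.continuous_on[OF bounded_linear_prod_left]
        bounded_bilinear.continuous_on[OF bounded_bilinear_blinfun_compose]
        C1_on_imp_continuous_on[OF f] C1_on_imp_continuous_on[OF g])
  ultimately show ?thesis unfolding C1_on_def by (intro exI[of _ ?h]) blast
qed

lemma C1_on_bounded_linear: "bounded_linear h \<Longrightarrow> C1_on S h"
  unfolding C1_on_def
  by (rule exI[of _ "\<lambda>_. Blinfun h"])
    (simp add: bounded_linear_Blinfun_apply bounded_linear_imp_has_derivative)

lemma C1_on_Pair_left: "C1_on S (\<lambda>u. (a, u))"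
proof -
  have "bounded_linear (\<lambda>h. (0::'b::real_normed_vector, h::'a::euclidean_space))"
    by (intro bounded_linear_Pair bounded_linear_zero bounded_linear_ident)
  then have "blinfun_apply (Blinfun (\<lambda>h. (0::'b, h::'a))) = (\<lambda>h. (0, h))"
    by (rule bounded_linear_Blinfun_apply)
  moreover have "((\<lambda>u. (a, u)) has_derivative (\<lambda>h. (0, h))) (at u)" for u :: 'a
    by (intro has_derivative_Pair has_derivative_const has_derivative_ident)
  ultimately show ?thesis
    unfolding C1_on_def by (intro exI[of _ "\<lambda>_. Blinfun (\<lambda>h. (0, h))"]) simp
qed

lemma C1_on_Pair_right: "C1_on S (\<lambda>u. (u, a))"
proof -
  have "bounded_linear (\<lambda>h. (h::'a::euclidean_space, 0::'b::real_normed_vector))"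
    by (intro bounded_linear_Pair bounded_linear_zero bounded_linear_ident)
  then have "blinfun_apply (Blinfun (\<lambda>h. (h::'a, 0::'b))) = (\<lambda>h. (h, 0))"
    by (rule bounded_linear_Blinfun_apply)
  moreover have "((\<lambda>u. (u, a)) has_derivative (\<lambda>h. (h, 0))) (at u)" for u :: 'a
    by (intro has_derivative_Pair has_derivative_const has_derivative_ident)
  ultimately show ?thesis
    unfolding C1_on_def by (intro exI[of _ "\<lambda>_. Blinfun (\<lambda>h. (h, 0))"]) simp
qed

lemma C2_onE:
  assumes "C2_on S f"
  obtains f' where "\<And>u. u \<in> S \<Longrightarrow> (f has_derivative blinfun_apply (f' u)) (at u)"
    and "C1_on S f'"
  using assms unfolding C2_on_def by blast

lemma C2_on_subset:
  assumes "C2_on S f" "T \<subseteq> S"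
  shows "C2_on T f"
proof -
  obtain f' where "\<And>u. u \<in> S \<Longrightarrow> (f has_derivative blinfun_apply (f' u)) (at u)"
    and "C1_on S f'"
    using assms(1) by (rule C2_onE) blast
  then show ?thesis
    using assms(2) C1_on_subset unfolding C2_on_def by (intro exI[of _ f']) blast
qed

lemma C2_on_imp_C1_on:
  assumes "C2_on S f"
  shows "C1_on S f"
proof -
  obtain f' where "\<And>u. u \<in> S \<Longrightarrow> (f has_derivative blinfun_apply (f' u)) (at u)"
    and "C1_on S f'"
    using assms by (rule C2_onE) blast
  then show ?thesis
    using C1_on_imp_continuous_on unfolding C1_on_def[of S f] by (intro exI[of _ f']) blast
qed

lemma C2_on_cong_open:
  assumes "C2_on S f" "open W" "S \<subseteq> W" "\<And>u. u \<in> W \<Longrightarrow> f u = g u"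
  shows "C2_on S g"
proof -
  obtain f' where f': "\<And>u. u \<in> S \<Longrightarrow> (f has_derivative blinfun_apply (f' u)) (at u)"
    and "C1_on S f'"
    using assms(1) by (rule C2_onE) blast
  moreover have "(g has_derivative blinfun_apply (f' u)) (at u)" if "u \<in> S" for u
    using has_derivative_transform_within_open[OF f'[OF that] assms(2)] assms(3,4) that by auto
  ultimately show ?thesis unfolding C2_on_def by blast
qed

text \<open>As in the case of class C1, the local first derivatives glue to one function, and that one is of
  class C1 by the preceding gluing lemma.\<close>

lemma C2_on_local:
  assumes "\<And>u. u \<in> S \<Longrightarrow> \<exists>N. open N \<and> u \<in> N \<and> C2_on N f"
  shows "C2_on S f"
proof -
  define f' where "f' u = (SOME D. (f has_derivative blinfun_apply D) (at u))" for u
  have *: "(f has_derivative blinfun_apply (f' u)) (at u) \<and> (\<exists>N. open N \<and> u \<in> N \<and> C1_on N f')"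
    if u: "u \<in> S" for u
  proof -
    obtain N where N: "open N" "u \<in> N" "C2_on N f"
      using assms[OF u] by blast
    obtain D where D: "\<And>v. v \<in> N \<Longrightarrow> (f has_derivative blinfun_apply (D v)) (at v)"
      and C1D: "C1_on N D"
      using N(3) by (rule C2_onE) blast
    have eq: "D v = f' v" if "v \<in> N" for v
    proof -
      have "(f has_derivative blinfun_apply (f' v)) (at v)"
        unfolding f'_def by (rule someI[where x = "D v"]) (rule D[OF that])
      then show ?thesis using D[OF that] by (rule derivative_blinfun_unique[rotated])
    qed
    have "C1_on N f'"
      by (rule C1_on_cong_open[OF C1D N(1) order_refl eq])
    then show ?thesis
      using N(1,2) D[OF N(2)] unfolding eq[OF N(2)] by blast
  qed
  have "C1_on S f'" by (rule C1_on_local) (rule *[THEN conjunct2])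
  then show ?thesis
    unfolding C2_on_def using *[THEN conjunct1] by (intro exI[of _ f']) blast
qed

lemma C2_on_compose:
  assumes f: "C2_on S f" and g: "C2_on T g" and sub: "f ` S \<subseteq> T"
  shows "C2_on S (g \<circ> f)"
proof -
  obtain f' where f': "\<And>u. u \<in> S \<Longrightarrow> (f has_derivative blinfun_apply (f' u)) (at u)"
    and C1f': "C1_on S f'"
    using f by (rule C2_onE) blast
  obtain g' where g': "\<And>u. u \<in> T \<Longrightarrow> (g has_derivative blinfun_apply (g' u)) (at u)"
    and C1g': "C1_on T g'"
    using g by (rule C2_onE) blast
  let ?h = "\<lambda>u. (g' \<circ> f) u o\<^sub>L f' u"
  have "((g \<circ> f) has_derivative blinfun_apply (?h u)) (at u)" if "u \<in> S" for u
  proof -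
    have "f u \<in> T" using sub that by blast
    then show ?thesis
      using diff_chain_at[OF f'[OF that] g'] by (simp add: blinfun_compose.rep_eq)
  qed
  moreover have "C1_on S ?h"
    using C1_on_compose[OF C2_on_imp_C1_on[OF f] C1g' sub] C1f'
    by (rule C1_on_bilinear[OF bounded_bilinear_blinfun_compose])
  ultimately show ?thesis unfolding C2_on_def by (intro exI[of _ ?h]) blast
qed

section \<open>Symmetry of the second derivative\<close>

text \<open>The second difference \<open>f (u + t a + t b) - f (u + t a) - f (u + t b) + f u\<close> is the increment
  over \<open>[0, 1]\<close> of \<open>s \<mapsto> f (u + t a + s t b) - f (u + s t b)\<close>.  The derivative of this function is
  the difference of two values of \<open>f'\<close> at points near u, which the differentiability of \<open>f'\<close> at u
  alone compares with \<open>t\<^sup>2 f'' a b\<close>; the mean value inequality does the rest.\<close>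

lemma second_difference_estimate:
  fixes f :: "'a::real_normed_vector \<Rightarrow> 'b::real_normed_vector" and f' :: "'a \<Rightarrow> 'a \<Rightarrow>\<^sub>L 'b"
  assumes "open S" "u \<in> S"
    and f: "\<And>v. v \<in> S \<Longrightarrow> (f has_derivative blinfun_apply (f' v)) (at v)"
    and f'': "(f' has_derivative f'') (at u)"
    and "e > 0"
  shows "\<forall>\<^sub>F t in at_right 0.
           norm (f (u + t *\<^sub>R a + t *\<^sub>R b) - f (u + t *\<^sub>R a) - f (u + t *\<^sub>R b) + f u - t\<^sup>2 *\<^sub>R f'' a b)
             \<le> e * t\<^sup>2"
proof -
  interpret f'': bounded_linear f'' using f'' by (rule has_derivative_bounded_linear)
  \<comment> \<open>The two error terms of \<open>f'\<close> contribute \<open>t (|a| + |b|)\<close> and \<open>t |b|\<close>, and evaluation at t b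
    contributes \<open>t |b|\<close>; adding 1 keeps the constant positive.\<close>
  define M where "M = (norm a + 2 * norm b) * norm b + 1"
  have M: "M > 0" unfolding M_def by (simp add: add_nonneg_pos)
  define e' where "e' = e / M"
  have e': "e' > 0" using M \<open>e > 0\<close> by (simp add: e'_def)
  obtain d1 where d1: "d1 > 0" "\<And>v. norm (v - u) < d1 \<Longrightarrow>
      norm (f' v - f' u - f'' (v - u)) \<le> e' * norm (v - u)"
    using f'' e' unfolding has_derivative_at_alt by blast
  obtain d2 where d2: "d2 > 0" "ball u d2 \<subseteq> S"
    using assms(1,2) open_contains_ball by blast
  define d where "d = min d1 d2 / (norm a + norm b + 1)"
  have pos: "norm a + norm b + 1 > 0" by (simp add: add_nonneg_pos)
  have d: "d > 0" using d1(1) d2(1) pos by (simp add: d_def)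
  have "norm (f (u + t *\<^sub>R a + t *\<^sub>R b) - f (u + t *\<^sub>R a) - f (u + t *\<^sub>R b) + f u - t\<^sup>2 *\<^sub>R f'' a b)
             \<le> e * t\<^sup>2" if t: "0 < t" "t < d" for t
  proof -
    have tm: "t * (norm a + norm b + 1) < min d1 d2"
      using t(2) pos by (simp add: d_def pos_less_divide_eq)
    have small: "norm (r *\<^sub>R a + s *\<^sub>R b) < d1" "norm (r *\<^sub>R a + s *\<^sub>R b) < d2"
        "norm (r *\<^sub>R a + s *\<^sub>R b) \<le> r * norm a + t * norm b"
      if "0 \<le> r" "r \<le> t" "0 \<le> s" "s \<le> t" for r s
    proof -
      have "norm (r *\<^sub>R a + s *\<^sub>R b) \<le> r * norm a + s * norm b"
        using norm_triangle_ineq[of "r *\<^sub>R a" "s *\<^sub>R b"] that by simp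
      moreover have "r * norm a \<le> t * norm a" "s * norm b \<le> t * norm b"
        using that by (simp_all add: mult_right_mono)
      moreover have "t * norm a + t * norm b < min d1 d2"
        using tm t(1) by (simp add: algebra_simps)
      ultimately show "norm (r *\<^sub>R a + s *\<^sub>R b) < d1" "norm (r *\<^sub>R a + s *\<^sub>R b) < d2"
        "norm (r *\<^sub>R a + s *\<^sub>R b) \<le> r * norm a + t * norm b"
        by linarith+
    qed
    define R where "R h = f' (u + h) - f' u - f'' h" for h
    have R: "norm (R h) \<le> e' * norm h" if "norm h < d1" for h
      using d1(2)[of "u + h"] that by (simp add: R_def)
    define \<psi> where "\<psi> s = f (u + t *\<^sub>R a + (s * t) *\<^sub>R b) - f (u + (s * t) *\<^sub>R b) - (s * t\<^sup>2) *\<^sub>R f'' a b"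
      for s :: real
    define \<psi>' where "\<psi>' s = t *\<^sub>R (f' (u + t *\<^sub>R a + (s * t) *\<^sub>R b) b - f' (u + (s * t) *\<^sub>R b) b)
        - t\<^sup>2 *\<^sub>R f'' a b" for s :: real
    have st: "0 \<le> s * t" "s * t \<le> t" if "s \<in> {0..1}" for s
      using that t(1) by (auto simp: mult_left_le_one_le)
    have der: "(\<psi> has_derivative (\<lambda>h. h *\<^sub>R \<psi>' s)) (at s within {0..1})" if s: "s \<in> {0..1}" for s
    proof -
      have in1: "u + t *\<^sub>R a + (s * t) *\<^sub>R b \<in> S"
        using small(2)[of t "s * t"] st[OF s] t d2(2) by (auto simp: dist_norm subset_iff add.assoc
             norm_minus_commute)
      have in2: "u + (s * t) *\<^sub>R b \<in> S"
        using small(2)[of 0 "s * t"] st[OF s] t d2(2) by (auto simp: dist_norm subset_iff)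
      have 1: "((\<lambda>s. f (u + t *\<^sub>R a + (s * t) *\<^sub>R b)) has_derivative
          (\<lambda>h. f' (u + t *\<^sub>R a + (s * t) *\<^sub>R b) ((h * t) *\<^sub>R b))) (at s within {0..1})"
        by (rule has_derivative_compose[where g = f and f = "\<lambda>s. u + t *\<^sub>R a + (s * t) *\<^sub>R b", OF _ f[OF in1]]) (auto intro!: derivative_eq_intros)
      have 2: "((\<lambda>s. f (u + (s * t) *\<^sub>R b)) has_derivative
          (\<lambda>h. f' (u + (s * t) *\<^sub>R b) ((h * t) *\<^sub>R b))) (at s within {0..1})"
        by (rule has_derivative_compose[where g = f and f = "\<lambda>s. u + (s * t) *\<^sub>R b", OF _ f[OF in2]]) (auto intro!: derivative_eq_intros)
      have 3: "((\<lambda>s. (s * t\<^sup>2) *\<^sub>R f'' a b) has_derivative (\<lambda>h. (h * t\<^sup>2) *\<^sub>R f'' a b))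
          (at s within {0..1})"
        by (auto intro!: derivative_eq_intros)
      show ?thesis
        using has_derivative_diff[OF has_derivative_diff[OF 1 2] 3]
        unfolding \<psi>_def[abs_def] \<psi>'_def
        by (simp add: blinfun.scaleR_right algebra_simps)
    qed
    have bound: "norm (\<psi>' s) \<le> e * t\<^sup>2" if s: "s \<in> {0..1}" for s
    proof -
      have "\<psi>' s = t *\<^sub>R ((R (t *\<^sub>R a + (s * t) *\<^sub>R b) - R ((s * t) *\<^sub>R b)) b)"
        unfolding \<psi>'_def R_def
        by (simp add: f''.add f''.scaleR blinfun.add_left blinfun.diff_left blinfun.scaleR_left
            algebra_simps power2_eq_square)
      then have "norm (\<psi>' s) \<le> t * (norm (R (t *\<^sub>R a + (s * t) *\<^sub>R b) - R ((s * t) *\<^sub>R b)) * norm b)"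
        using t(1) norm_blinfun[of "R (t *\<^sub>R a + (s * t) *\<^sub>R b) - R ((s * t) *\<^sub>R b)" b] by simp
      also have "\<dots> \<le> t * ((e' * (t * norm a + t * norm b) + e' * (t * norm b)) * norm b)"
      proof -
        have "norm (R (t *\<^sub>R a + (s * t) *\<^sub>R b)) \<le> e' * (t * norm a + t * norm b)"
          using R[of "t *\<^sub>R a + (s * t) *\<^sub>R b"] small(1,3)[of t "s * t"] st[OF s] t e'
          by (meson less_eq_real_def mult_left_mono order_trans)
        moreover have "norm (R ((s * t) *\<^sub>R b)) \<le> e' * (t * norm b)"
        proof -
          have "norm ((s * t) *\<^sub>R b) < d1" "norm ((s * t) *\<^sub>R b) \<le> t * norm b"
            using small(1,3)[of 0 "s * t"] st[OF s] t by auto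
          then show ?thesis
            using R[of "(s * t) *\<^sub>R b"] e' by (meson less_eq_real_def mult_left_mono order_trans)
        qed
        ultimately have "norm (R (t *\<^sub>R a + (s * t) *\<^sub>R b) - R ((s * t) *\<^sub>R b))
            \<le> e' * (t * norm a + t * norm b) + e' * (t * norm b)"
          by (smt (verit) norm_triangle_ineq4)
        then show ?thesis using t(1) by (intro mult_left_mono mult_right_mono) auto
      qed
      also have "\<dots> = t\<^sup>2 * (e' * (M - 1))"
        unfolding M_def by (simp add: algebra_simps power2_eq_square)
      also have "\<dots> \<le> t\<^sup>2 * (e' * M)"
        using e' by (intro mult_left_mono) auto
      also have "\<dots> = e * t\<^sup>2" using M by (simp add: e'_def)
      finally show ?thesis .
    qed
    have "norm (\<psi> 1 - \<psi> 0) \<le> e * t\<^sup>2 * norm (1 - 0 :: real)"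
    proof (rule differentiable_bound[of "{0..1}" \<psi> "\<lambda>s h. h *\<^sub>R \<psi>' s"])
      show "onorm (\<lambda>h. h *\<^sub>R \<psi>' s) \<le> e * t\<^sup>2" if "s \<in> {0..1}" for s
      proof (rule onorm_bound)
        show "0 \<le> e * t\<^sup>2" using \<open>e > 0\<close> by simp
        show "norm (h *\<^sub>R \<psi>' s) \<le> e * t\<^sup>2 * norm h" for h
          using mult_left_mono[OF bound[OF that], of "norm h"] by (simp add: mult.commute)
      qed
    qed (use der in auto)
    then show ?thesis
      unfolding \<psi>_def by (simp add: algebra_simps)
  qed
  then show ?thesis
    using d unfolding eventually_at_right_field by blast
qed

text \<open>The second difference is symmetric in a and b, while the preceding estimate identifies its
  leading term with \<open>t\<^sup>2 f'' a b\<close> as well as with \<open>t\<^sup>2 f'' b a\<close>.\<close>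

lemma second_derivative_symmetric:
  fixes f :: "'a::real_normed_vector \<Rightarrow> 'b::real_normed_vector" and f' :: "'a \<Rightarrow> 'a \<Rightarrow>\<^sub>L 'b"
  assumes "open S" "u \<in> S"
    and "\<And>v. v \<in> S \<Longrightarrow> (f has_derivative blinfun_apply (f' v)) (at v)"
    and "(f' has_derivative f'') (at u)"
  shows "f'' a b = f'' b a"
proof -
  have "norm (f'' a b - f'' b a) \<le> 2 * e" if "e > 0" for e
  proof -
    let ?D = "\<lambda>t a b. f (u + t *\<^sub>R a + t *\<^sub>R b) - f (u + t *\<^sub>R a) - f (u + t *\<^sub>R b) + f u"
    have "\<forall>\<^sub>F t in at_right (0::real). 0 < t \<and> norm (?D t a b - t\<^sup>2 *\<^sub>R f'' a b) \<le> e * t\<^sup>2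
        \<and> norm (?D t b a - t\<^sup>2 *\<^sub>R f'' b a) \<le> e * t\<^sup>2"
      using second_difference_estimate[OF assms that]
      by (intro eventually_conj eventually_at_right_less) auto
    then obtain t where t: "0 < t" "norm (?D t a b - t\<^sup>2 *\<^sub>R f'' a b) \<le> e * t\<^sup>2"
        "norm (?D t b a - t\<^sup>2 *\<^sub>R f'' b a) \<le> e * t\<^sup>2"
      using eventually_happens trivial_limit_at_right_real by blast
    have "t\<^sup>2 *\<^sub>R (f'' a b - f'' b a) = (?D t b a - t\<^sup>2 *\<^sub>R f'' b a) - (?D t a b - t\<^sup>2 *\<^sub>R f'' a b)"
      by (simp add: algebra_simps)
    then have "norm (t\<^sup>2 *\<^sub>R (f'' a b - f'' b a)) \<le> e * t\<^sup>2 + e * t\<^sup>2"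
      using t(2,3) by (smt (verit) norm_triangle_ineq4)
    then have "t\<^sup>2 * norm (f'' a b - f'' b a) \<le> t\<^sup>2 * (2 * e)"
      unfolding norm_scaleR by (simp add: mult.left_commute mult.commute)
    then show ?thesis using t(1) by (simp add: mult_le_cancel_left)
  qed
  from this[of "norm (f'' a b - f'' b a) / 4"] show ?thesis
    by (cases "f'' a b = f'' b a") auto
qed

section \<open>Closed forms and coordinates adapted to a frame\<close>

text \<open>The Poincare lemma for 1-forms of class C1 with values in a Banach space.  The primitive is the
  integral of G along the segments from a fixed point \<open>u\<^sub>0\<close>.  Differentiating under the integral
  and exchanging the two arguments of \<open>G'\<close> turns the integrand into the derivative of
  \<open>t \<mapsto> t G (u\<^sub>0 + t (u - u\<^sub>0))\<close>, so that its integral over \<open>[0, 1]\<close> is \<open>G u\<close>.\<close>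

lemma closed_form_has_primitive:
  fixes G :: "'a::euclidean_space \<Rightarrow> 'a \<Rightarrow>\<^sub>L 'b::banach" and G' :: "'a \<Rightarrow> 'a \<Rightarrow>\<^sub>L 'a \<Rightarrow>\<^sub>L 'b"
  assumes "open S" "convex S"
    and G: "\<And>u. u \<in> S \<Longrightarrow> (G has_derivative blinfun_apply (G' u)) (at u)"
    and contG': "continuous_on S G'"
    and closed: "\<And>u a b. u \<in> S \<Longrightarrow> G' u a b = G' u b a"
  shows "\<exists>\<phi>. \<forall>u\<in>S. (\<phi> has_derivative blinfun_apply (G u)) (at u)"
proof (cases "S = {}")
  case False
  then obtain u0 where u0: "u0 \<in> S" by blast
  define w where "w u t = u0 + t *\<^sub>R (u - u0)" for u and t :: real
  have w: "w u t \<in> S" if "u \<in> S" "t \<in> {0..1}" for u t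
  proof -
    have "w u t = (1 - t) *\<^sub>R u0 + t *\<^sub>R u" by (simp add: w_def algebra_simps)
    then show ?thesis using that u0 \<open>convex S\<close> by (simp add: convex_alt)
  qed
  have contG: "continuous_on S G"
    using G by (meson continuous_at_imp_continuous_on has_derivative_continuous)
  define fx where "fx u t = t *\<^sub>R G' (w u t) (u - u0) + G (w u t)" for u t
  have int: "((fx u) has_integral G u) {0..1}" if u: "u \<in> S" for u
  proof -
    have "((\<lambda>t. t *\<^sub>R G (w u t)) has_vector_derivative fx u t) (at t within {0..1})"
      if t: "t \<in> {0..1}" for t
    proof -
      have "((\<lambda>t. G (w u t)) has_derivative (\<lambda>h. G' (w u t) (h *\<^sub>R (u - u0)))) (at t within {0..1})"
        by (rule has_derivative_compose[where g = G and f = "w u", OF _ G[OF w[OF u t]]])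
          (auto simp: w_def[abs_def] intro!: derivative_eq_intros)
      then have "((\<lambda>t. t *\<^sub>R G (w u t)) has_derivative
          (\<lambda>h. t *\<^sub>R G' (w u t) (h *\<^sub>R (u - u0)) + h *\<^sub>R G (w u t))) (at t within {0..1})"
        by (intro has_derivative_scaleR has_derivative_ident)
      then show ?thesis
        unfolding has_vector_derivative_def fx_def
        by (rule has_derivative_eq_rhs) (simp add: blinfun.scaleR_right scaleR_add_right fun_eq_iff mult.commute add.commute)
    qed
    from fundamental_theorem_of_calculus[of 0 1, OF _ this] show ?thesis
      by (simp add: w_def)
  qed
  define \<phi> where "\<phi> u = integral (cbox 0 1) (\<lambda>t. G (w u t) (u - u0))" for u
  have contw: "continuous_on X (\<lambda>(u, t). w u t)" for X
    unfolding w_def split_def by (intro continuous_intros)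
  have "(\<phi> has_derivative blinfun_apply (G u)) (at u)" if u: "u \<in> S" for u
  proof -
    have "(\<phi> has_derivative blinfun_apply (integral (cbox 0 1) (fx u))) (at u within S)"
      unfolding \<phi>_def
    proof (rule leibniz_rule[OF _ _ _ u \<open>convex S\<close>])
      fix v and t :: real
      assume v: "v \<in> S" and t: "t \<in> cbox 0 1"
      have "(G has_derivative blinfun_apply (G' (w v t))) (at (w v t))"
        using G w[OF v] t by auto
      then have "((\<lambda>v. G (w v t)) has_derivative (\<lambda>h. G' (w v t) (t *\<^sub>R h))) (at v within S)"
        by (rule has_derivative_compose[where g = G and f = "\<lambda>v. w v t", rotated]) (auto simp: w_def intro!: derivative_eq_intros)
      then have "((\<lambda>v. G (w v t) (v - u0)) has_derivative
          (\<lambda>h. G (w v t) h + G' (w v t) (t *\<^sub>R h) (v - u0))) (at v within S)"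
        by (rule blinfun.FDERIV[THEN has_derivative_eq_rhs]) (auto intro!: derivative_eq_intros)
      \<comment> \<open>Here closedness enters: \<open>fx\<close> has the direction h as its last argument.\<close>
      moreover have "G (w v t) h + G' (w v t) (t *\<^sub>R h) (v - u0) = fx v t h" for h
        using closed[of "w v t" h "v - u0"] w[OF v] t
        by (simp add: fx_def blinfun.scaleR_right blinfun.scaleR_left blinfun.add_left)
      ultimately show "((\<lambda>v. G (w v t) (v - u0)) has_derivative blinfun_apply (fx v t)) (at v within S)"
        by simp
    next
      fix v assume v: "v \<in> S"
      have "continuous_on {0..1} (\<lambda>t. w v t)"
        unfolding w_def by (intro continuous_intros)
      then show "(\<lambda>t. G (w v t) (v - u0)) integrable_on cbox 0 1"
        using w[OF v]
        by (intro integrable_continuous continuous_intros continuous_on_compose2[OF contG]) auto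
    next
      have "(\<lambda>(u, t). w u t) ` (S \<times> cbox 0 1) \<subseteq> S"
        using w by auto
      from continuous_on_compose2[OF contG' contw this] continuous_on_compose2[OF contG contw this]
      show "continuous_on (S \<times> cbox 0 1) (\<lambda>(u, t). fx u t)"
        unfolding fx_def split_def by (intro continuous_intros)
    qed
    moreover have "integral (cbox 0 1) (fx u) = G u"
      using int[OF u] by (simp add: integral_unique)
    ultimately show ?thesis
      using at_within_open[OF u \<open>open S\<close>] by simp
  qed
  then show ?thesis by blast
qed simp

text \<open>If the coframe G dual to a frame F is closed, then F is a frame of coordinate vector fields:
  a primitive \<open>\<phi>\<close> of G has invertible derivative, hence is a local diffeomorphism, and the derivative
  of its inverse \<open>\<psi>\<close> is F.  As F and G are both of class C1, the maps \<open>\<phi>\<close> and \<open>\<psi>\<close> are of class C2.\<close>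

lemma closed_coframe_coordinates:
  fixes F G :: "'a::euclidean_space \<Rightarrow> 'a \<Rightarrow>\<^sub>L 'a" and G' :: "'a \<Rightarrow> 'a \<Rightarrow> 'a \<Rightarrow>\<^sub>L 'a"
  assumes "open R" "u0 \<in> R"
    and C1F: "C1_on R F" and C1G: "C1_on R G"
    and FG: "\<And>u. u \<in> R \<Longrightarrow> F u o\<^sub>L G u = id_blinfun"
    and GF: "\<And>u. u \<in> R \<Longrightarrow> G u o\<^sub>L F u = id_blinfun"
    and G': "\<And>u. u \<in> R \<Longrightarrow> (G has_derivative G' u) (at u)"
    and closed: "\<And>u a b. u \<in> R \<Longrightarrow> G' u a b = G' u b a"
  obtains W V \<phi> \<psi> where "open W" "u0 \<in> W" "W \<subseteq> R" "open V" "homeomorphism W V \<phi> \<psi>"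
    "C2_on W \<phi>" "C2_on V \<psi>"
    "\<And>v. v \<in> V \<Longrightarrow> (\<psi> has_derivative blinfun_apply (F (\<psi> v))) (at v)"
proof -
  obtain r where r: "r > 0" "ball u0 r \<subseteq> R"
    using \<open>open R\<close> \<open>u0 \<in> R\<close> open_contains_ball by blast
  obtain D where D: "\<And>u. u \<in> R \<Longrightarrow> (G has_derivative blinfun_apply (D u)) (at u)"
    and contD: "continuous_on R D"
    using C1G by (rule C1_onE) blast
  have "D u a b = D u b a" if "u \<in> R" for u a b
    using closed[OF that] has_derivative_unique[OF D[OF that] G'[OF that]] by simp
  then have "\<exists>\<phi>. \<forall>u\<in>ball u0 r. (\<phi> has_derivative blinfun_apply (G u)) (at u)"
    using D r(2) continuous_on_subset[OF contD r(2)]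
    by (intro closed_form_has_primitive[of "ball u0 r" G D]) auto
  then obtain \<phi> where \<phi>: "\<And>u. u \<in> ball u0 r \<Longrightarrow> (\<phi> has_derivative blinfun_apply (G u)) (at u)"
    by blast
  have "continuous_on (ball u0 r) G"
    using C1_on_imp_continuous_on[OF C1G] r(2) continuous_on_subset by blast
  from inverse_function_theorem[OF open_ball \<phi> this _ FG[OF \<open>u0 \<in> R\<close>]] r(1)
  obtain W V \<psi> \<psi>' where W: "open W" "W \<subseteq> ball u0 r" "u0 \<in> W" and V: "open V"
    and hom: "homeomorphism W V \<phi> \<psi>"
    and \<psi>': "\<And>v. v \<in> V \<Longrightarrow> (\<psi> has_derivative (\<psi>' v)) (at v)"
      "\<And>v. v \<in> V \<Longrightarrow> \<psi>' v = inv (blinfun_apply (G (\<psi> v)))"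
    by (metis centre_in_ball)
  have WR: "W \<subseteq> R" using W(2) r(2) by blast
  have \<psi>W: "\<psi> v \<in> W" if "v \<in> V" for v
    using hom that by (auto simp: homeomorphism_def)
  have der: "(\<psi> has_derivative blinfun_apply (F (\<psi> v))) (at v)" if v: "v \<in> V" for v
  proof -
    have R: "\<psi> v \<in> R" using \<psi>W[OF v] WR by blast
    have "G (\<psi> v) (F (\<psi> v) b) = b" "F (\<psi> v) (G (\<psi> v) b) = b" for b
      using GF[OF R] FG[OF R] by (metis blinfun_apply_blinfun_compose blinfun_apply_id_blinfun)+
    then have "inv (blinfun_apply (G (\<psi> v))) = blinfun_apply (F (\<psi> v))"
      by (intro inv_unique_comp) (auto simp: fun_eq_iff)
    then show ?thesis using \<psi>'(1)[OF v] \<psi>'(2)[OF v] by simp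
  qed
  have "C2_on W \<phi>"
    unfolding C2_on_def
    by (intro exI[of _ G] conjI ballI C1_on_subset[OF C1G WR] \<phi>) (use W(2) in blast)
  moreover have "C2_on V \<psi>"
  proof -
    have "continuous_on V \<psi>" using hom by (simp add: homeomorphism_def)
    then have "continuous_on V (\<lambda>v. F (\<psi> v))"
      using \<psi>W WR by (intro continuous_on_compose2[OF C1_on_imp_continuous_on[OF C1F]]) auto
    then have C1: "C1_on V \<psi>"
      unfolding C1_on_def using der by (intro exI[of _ "\<lambda>v. F (\<psi> v)"]) blast
    have "C1_on V (F \<circ> \<psi>)"
      using \<psi>W WR by (intro C1_on_compose[OF C1 C1F]) auto
    then show ?thesis
      unfolding C2_on_def using der by (intro exI[of _ "F \<circ> \<psi>"]) simp
  qed
  ultimately show ?thesis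
    using that[OF W(1,3) WR V hom _ _ der] by blast
qed

lemma bounded_bilinear_matrix_vector_mult:
  "bounded_bilinear ((*v) :: real ^ 'n ^ 'm \<Rightarrow> real ^ 'n \<Rightarrow> real ^ 'm)"
  unfolding bilinear_conv_bounded_bilinear[symmetric] bilinear_def
proof (intro conjI allI linearI)
  show "(r *\<^sub>R A) *v x = r *\<^sub>R (A *v x)" for r and A :: "real ^ 'n ^ 'm" and x
    by (rule scaleR_matrix_vector_assoc[symmetric])
qed (simp_all add: matrix_vector_mult_add_rdistrib matrix_vector_right_distrib
      matrix_vector_mult_scaleR)

section \<open>Charts and changes of coordinates\<close>

lemma is_chart_inj: "is_chart M c \<Longrightarrow> inj_on (chart_map c) (chart_dom c)"
  unfolding is_chart_def
  by (metis homeomorphic_imp_injective_map inf.absorb_iff2 openin_subset topspace_subtopology)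

lemma chart_inv_chart_map:
  "is_chart M c \<Longrightarrow> x \<in> chart_dom c \<Longrightarrow> chart_inv c (chart_map c x) = x"
  by (simp add: chart_inv_def is_chart_inj)

lemma chart_inv_in_dom: "u \<in> chart_range c \<Longrightarrow> chart_inv c u \<in> chart_dom c"
  by (simp add: chart_inv_def inv_into_into)

lemma chart_map_chart_inv: "u \<in> chart_range c \<Longrightarrow> chart_map c (chart_inv c u) = u"
  by (simp add: chart_inv_def f_inv_into_f)

lemma is_chart_open_dom: "is_chart M c \<Longrightarrow> openin M (chart_dom c)"
  by (simp add: is_chart_def)

lemma is_chart_open_range: "is_chart M c \<Longrightarrow> open (chart_range c)"
  by (simp add: is_chart_def)

lemma open_chart_image:
  assumes "is_chart M c" "openin M W" "W \<subseteq> chart_dom c"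
  shows "open (chart_map c ` W)"
proof -
  have "openin (subtopology M (chart_dom c)) W"
    using assms(2,3) by (simp add: openin_subset_topspace_eq openin_subtopology_Int2 inf.absorb_iff2 subset_openin_subtopology)
  then have "openin (top_of_set (chart_range c)) (chart_map c ` W)"
    using assms unfolding is_chart_def
    by (metis homeomorphic_map_openness_eq)
  then show ?thesis
    using openin_open_trans is_chart_open_range[OF assms(1)] by blast
qed

lemma openin_chart_preimage:
  assumes "is_chart M c" "open O'"
  shows "openin M {x \<in> chart_dom c. chart_map c x \<in> O'}"
proof -
  have "continuous_map (subtopology M (chart_dom c)) (top_of_set (chart_range c)) (chart_map c)"
    using assms(1) by (simp add: is_chart_def homeomorphic_imp_continuous_map)
  moreover have "openin (top_of_set (chart_range c)) (chart_range c \<inter> O')"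
    using assms(2) by (simp add: openin_open_Int)
  ultimately have "openin (subtopology M (chart_dom c))
      {x \<in> topspace (subtopology M (chart_dom c)). chart_map c x \<in> chart_range c \<inter> O'}"
    by (rule openin_continuous_map_preimage)
  moreover have "{x \<in> topspace (subtopology M (chart_dom c)). chart_map c x \<in> chart_range c \<inter> O'}
      = {x \<in> chart_dom c. chart_map c x \<in> O'}"
    using openin_subset[OF is_chart_open_dom[OF assms(1)]] by auto
  ultimately show ?thesis
    using openin_trans_full is_chart_open_dom[OF assms(1)] by metis
qed

lemma local_coords_is_chart: "c \<in> local_coords M \<A> \<Longrightarrow> is_chart M c"
  by (simp add: local_coords_def)

lemma atlas_subset_local_coords: "C2_manifold M \<A> \<Longrightarrow> \<A> \<subseteq> local_coords M \<A>"
  by (auto simp: C2_manifold_def local_coords_def)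

lemma transition_eq_compose:
  assumes e: "is_chart M e" and c: "is_chart M c"
    and u: "u \<in> chart_map c ` (chart_dom c \<inter> chart_dom e)"
  shows "(chart_map d \<circ> chart_inv c) u
    = ((chart_map d \<circ> chart_inv e) \<circ> (chart_map e \<circ> chart_inv c)) u"
  using u chart_inv_chart_map[OF c] chart_inv_chart_map[OF e] by auto

text \<open>Local coordinates are only required to be compatible with the charts of the atlas.  Near each
  point the change between two of them factors through a chart of the atlas, so it is of class C2 too.\<close>

lemma transition_C2_on:
  assumes A: "C2_manifold M \<A>" and c: "c \<in> local_coords M \<A>" and d: "d \<in> local_coords M \<A>"
  shows "C2_on (chart_map c ` (chart_dom c \<inter> chart_dom d)) (chart_map d \<circ> chart_inv c)"
proof (rule C2_on_local)
  fix u assume "u \<in> chart_map c ` (chart_dom c \<inter> chart_dom d)"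
  then obtain x where x: "x \<in> chart_dom c" "x \<in> chart_dom d" "u = chart_map c x" by blast
  have cc: "is_chart M c" and dc: "is_chart M d"
    using c d by (auto simp: local_coords_def)
  have "x \<in> topspace M"
    using x(1) is_chart_open_dom[OF cc] openin_subset by blast
  then obtain e where e: "e \<in> \<A>" "x \<in> chart_dom e"
    using A unfolding C2_manifold_def by blast
  have ec: "is_chart M e" using A e(1) by (simp add: C2_manifold_def)
  define N where "N = chart_map c ` (chart_dom c \<inter> chart_dom d \<inter> chart_dom e)"
  have "openin M (chart_dom c \<inter> chart_dom d \<inter> chart_dom e)"
    using cc dc ec by (intro openin_Int is_chart_open_dom)
  then have N: "open N" unfolding N_def by (rule open_chart_image[OF cc]) blast
  have 1: "C2_on N (chart_map e \<circ> chart_inv c)"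
    using c e(1) unfolding local_coords_def C2_compatible_def N_def
    by (blast intro: C2_on_subset)
  have 2: "C2_on (chart_map e ` (chart_dom d \<inter> chart_dom e)) (chart_map d \<circ> chart_inv e)"
    using d e(1) unfolding local_coords_def C2_compatible_def by blast
  have "(chart_map e \<circ> chart_inv c) ` N \<subseteq> chart_map e ` (chart_dom d \<inter> chart_dom e)"
    unfolding N_def using chart_inv_chart_map[OF cc] by auto
  from C2_on_compose[OF 1 2 this] have "C2_on N (chart_map d \<circ> chart_inv c)"
  proof (rule C2_on_cong_open[OF _ N order_refl])
    show "((chart_map d \<circ> chart_inv e) \<circ> (chart_map e \<circ> chart_inv c)) v = (chart_map d \<circ> chart_inv c) v"
      if "v \<in> N" for v
      by (rule transition_eq_compose[OF ec cc, symmetric]) (use that in \<open>auto simp: N_def\<close>)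
  qed
  then show "\<exists>N. open N \<and> u \<in> N \<and> C2_on N (chart_map d \<circ> chart_inv c)"
    using N x e(2) unfolding N_def by blast
qed

lemma transition_has_derivative_jacobian:
  assumes A: "C2_manifold M \<A>" and c: "c \<in> coords_at M \<A> x" and d: "d \<in> coords_at M \<A> x"
  shows "((chart_map d \<circ> chart_inv c) has_derivative (*v) (jacobian c d x)) (at (chart_map c x))"
proof -
  have "(chart_map d \<circ> chart_inv c) differentiable (at (chart_map c x))"
    using C1_on_imp_differentiable[OF C2_on_imp_C1_on[OF transition_C2_on[OF A, of c d]]] c d
    by (auto simp: coords_at_def)
  then have D: "((chart_map d \<circ> chart_inv c) has_derivative
      frechet_derivative (chart_map d \<circ> chart_inv c) (at (chart_map c x))) (at (chart_map c x))"
    by (simp add: frechet_derivative_works)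
  then show ?thesis
    unfolding jacobian_def
    by (simp add: matrix_vector_mul(2)[OF has_derivative_linear[OF D]] eta_contract_eq)
qed

lemma jacobian_chain:
  assumes A: "C2_manifold M \<A>" and c: "c \<in> coords_at M \<A> x" and d: "d \<in> coords_at M \<A> x"
    and e: "e \<in> coords_at M \<A> x"
  shows "jacobian c e x = jacobian d e x ** jacobian c d x"
proof -
  have cc: "is_chart M c" and dc: "is_chart M d" and xc: "x \<in> chart_dom c" and xd: "x \<in> chart_dom d"
    using c d by (auto simp: coords_at_def local_coords_def)
  define N where "N = chart_map c ` (chart_dom c \<inter> chart_dom d)"
  have N: "open N"
    unfolding N_def using cc dc by (intro open_chart_image[OF cc] openin_Int is_chart_open_dom) auto
  have "((chart_map d \<circ> chart_inv c) has_derivative (*v) (jacobian c d x)) (at (chart_map c x))"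
    by (rule transition_has_derivative_jacobian[OF A c d])
  moreover have "((chart_map e \<circ> chart_inv d) has_derivative (*v) (jacobian d e x))
      (at ((chart_map d \<circ> chart_inv c) (chart_map c x)))"
    using transition_has_derivative_jacobian[OF A d e] by (simp add: chart_inv_chart_map[OF cc xc])
  ultimately have "((chart_map e \<circ> chart_inv d) \<circ> (chart_map d \<circ> chart_inv c) has_derivative
      (*v) (jacobian d e x) \<circ> (*v) (jacobian c d x)) (at (chart_map c x))"
    by (rule diff_chain_at)
  moreover have "(chart_map e \<circ> chart_inv d \<circ> (chart_map d \<circ> chart_inv c)) v = (chart_map e \<circ> chart_inv c) v"
    if "v \<in> N" for v
    using that transition_eq_compose[OF dc cc, of v e] unfolding N_def by simp
  ultimately have "((chart_map e \<circ> chart_inv c) has_derivative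
      (*v) (jacobian d e x) \<circ> (*v) (jacobian c d x)) (at (chart_map c x))"
    using has_derivative_transform_within_open[OF _ N] xc xd unfolding N_def by blast
  from has_derivative_unique[OF this transition_has_derivative_jacobian[OF A c e]]
  have "jacobian c e x *v v = (jacobian d e x ** jacobian c d x) *v v" for v
    by (metis comp_apply matrix_vector_mul_assoc)
  then show ?thesis by (simp add: matrix_eq)
qed

lemma jacobian_self:
  assumes "c \<in> coords_at M \<A> x"
  shows "jacobian c c x = mat 1"
proof -
  have cc: "is_chart M c" and x: "x \<in> chart_dom c"
    using assms by (auto simp: coords_at_def local_coords_def)
  have "(id has_derivative id) (at (chart_map c x))"
    by (simp add: id_def)
  then have "((chart_map c \<circ> chart_inv c) has_derivative id) (at (chart_map c x))"
    by (rule has_derivative_transform_within_open[OF _ is_chart_open_range[OF cc]])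
      (use x in \<open>auto simp: chart_inv_chart_map[OF cc]\<close>)
  from frechet_derivative_at[OF this] show ?thesis
    by (simp add: jacobian_def matrix_id_mat_1)
qed

definition composed_chart :: "('m, 'n) chart \<Rightarrow> (real ^ 'n) set \<Rightarrow> (real ^ 'n \<Rightarrow> real ^ 'n) \<Rightarrow> ('m, 'n) chart"
  where "composed_chart c W \<phi> = ({x \<in> chart_dom c. chart_map c x \<in> W}, \<phi> \<circ> chart_map c)"

lemma composed_chart_is_chart:
  assumes c: "is_chart M c" and W: "open W" "W \<subseteq> chart_range c" and V: "open V"
    and hom: "homeomorphism W V \<phi> \<psi>"
  shows "is_chart M (composed_chart c W \<phi>)" "chart_range (composed_chart c W \<phi>) = V"
    "\<And>v. v \<in> V \<Longrightarrow> chart_inv (composed_chart c W \<phi>) v = chart_inv c (\<psi> v)"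
proof -
  let ?d = "composed_chart c W \<phi>"
  have im: "chart_map c ` chart_dom ?d = W"
    using W(2) by (auto simp: composed_chart_def)
  show ran: "chart_range ?d = V"
  proof -
    have "chart_range ?d = \<phi> ` (chart_map c ` chart_dom ?d)"
      by (auto simp: composed_chart_def)
    then show ?thesis using im homeomorphism_image1[OF hom] by simp
  qed
  have dom: "openin M (chart_dom ?d)"
    using openin_chart_preimage[OF c W(1)] by (simp add: composed_chart_def)
  have sub: "chart_dom ?d \<subseteq> chart_dom c" by (auto simp: composed_chart_def)
  have "homeomorphic_map (subtopology M (chart_dom c)) (top_of_set (chart_range c)) (chart_map c)"
    using c by (simp add: is_chart_def)
  then have "homeomorphic_map (subtopology (subtopology M (chart_dom c)) (chart_dom ?d))
      (subtopology (top_of_set (chart_range c)) W) (chart_map c)"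
  proof (rule homeomorphic_map_subtopologies)
    have "topspace (subtopology M (chart_dom c)) \<inter> chart_dom ?d = chart_dom ?d"
      using sub openin_subset[OF dom] by auto
    then show "chart_map c ` (topspace (subtopology M (chart_dom c)) \<inter> chart_dom ?d)
        = topspace (top_of_set (chart_range c)) \<inter> W"
      using im W(2) by auto
  qed
  then have "homeomorphic_map (subtopology M (chart_dom ?d)) (top_of_set W) (chart_map c)"
    using sub W(2) by (simp add: subtopology_subtopology inf.absorb2)
  moreover have "homeomorphic_map (top_of_set W) (top_of_set V) \<phi>"
    unfolding homeomorphic_map_maps homeomorphic_maps_def
    using hom by (intro exI[of _ \<psi>]) (auto simp: homeomorphism_def)
  ultimately have "homeomorphic_map (subtopology M (chart_dom ?d)) (top_of_set V) (\<phi> \<circ> chart_map c)"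
    by (rule homeomorphic_map_compose)
  then show chart: "is_chart M ?d"
    using dom V ran by (simp add: is_chart_def) (simp add: composed_chart_def)
  fix v assume v: "v \<in> V"
  then have "\<psi> v \<in> W" "\<phi> (\<psi> v) = v" using hom by (auto simp: homeomorphism_def)
  moreover have "chart_inv c (\<psi> v) \<in> chart_dom ?d" "chart_map c (chart_inv c (\<psi> v)) = \<psi> v"
    using chart_inv_in_dom[of "\<psi> v" c] chart_map_chart_inv[of "\<psi> v" c] \<open>\<psi> v \<in> W\<close> W(2)
    by (auto simp: composed_chart_def)
  ultimately show "chart_inv ?d v = chart_inv c (\<psi> v)"
    using chart_inv_chart_map[OF chart, of "chart_inv c (\<psi> v)"] by (simp add: composed_chart_def)
qed

text \<open>Both changes of coordinates between the new chart and a chart e of the atlas are the corresponding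
  change between c and e, composed with \<open>\<phi>\<close> or \<open>\<psi>\<close>.\<close>

lemma composed_chart_local_coords:
  assumes A: "C2_manifold M \<A>" and c: "c \<in> local_coords M \<A>"
    and W: "open W" "W \<subseteq> chart_range c" and V: "open V"
    and hom: "homeomorphism W V \<phi> \<psi>" and \<phi>: "C2_on W \<phi>" and \<psi>: "C2_on V \<psi>"
  shows "composed_chart c W \<phi> \<in> local_coords M \<A>"
proof -
  let ?d = "composed_chart c W \<phi>"
  have cc: "is_chart M c" using c by (rule local_coords_is_chart)
  note d = composed_chart_is_chart[OF cc W V hom]
  have sub: "chart_dom ?d \<subseteq> chart_dom c" by (auto simp: composed_chart_def)
  have "C2_compatible ?d e" if "e \<in> \<A>" for e
  proof -
    have e: "e \<in> local_coords M \<A>" using that atlas_subset_local_coords[OF A] by blast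
    have ec: "is_chart M e" using e by (rule local_coords_is_chart)
    have "C2_on (chart_map ?d ` (chart_dom ?d \<inter> chart_dom e)) ((chart_map e \<circ> chart_inv c) \<circ> \<psi>)"
    proof (rule C2_on_compose[OF C2_on_subset[OF \<psi>] transition_C2_on[OF A c e]])
      show "chart_map ?d ` (chart_dom ?d \<inter> chart_dom e) \<subseteq> V" using d(2) by blast
      show "\<psi> ` chart_map ?d ` (chart_dom ?d \<inter> chart_dom e) \<subseteq> chart_map c ` (chart_dom c \<inter> chart_dom e)"
        using hom by (auto simp: composed_chart_def homeomorphism_def)
    qed
    then have "C2_on (chart_map ?d ` (chart_dom ?d \<inter> chart_dom e)) (chart_map e \<circ> chart_inv ?d)"
      by (rule C2_on_cong_open[OF _ V]) (use d(2,3) in auto)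
    moreover have "C2_on (chart_map e ` (chart_dom ?d \<inter> chart_dom e)) (\<phi> \<circ> (chart_map c \<circ> chart_inv e))"
    proof (rule C2_on_compose[OF C2_on_subset[OF transition_C2_on[OF A e c]] \<phi>])
      show "chart_map e ` (chart_dom ?d \<inter> chart_dom e) \<subseteq> chart_map e ` (chart_dom e \<inter> chart_dom c)"
        using sub by blast
      show "(chart_map c \<circ> chart_inv e) ` chart_map e ` (chart_dom ?d \<inter> chart_dom e) \<subseteq> W"
        using chart_inv_chart_map[OF ec] by (auto simp: composed_chart_def)
    qed
    then have "C2_on (chart_map e ` (chart_dom ?d \<inter> chart_dom e)) (chart_map ?d \<circ> chart_inv e)"
      by (simp add: composed_chart_def o_assoc)
    ultimately show ?thesis by (simp add: C2_compatible_def)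
  qed
  then show ?thesis using d(1) by (simp add: local_coords_def)
qed

section \<open>Tangent vectors as tensors of type (1, 0)\<close>

definition vec_of :: "('m, 'n) chart \<Rightarrow> ('m, 'n::finite) tensor \<Rightarrow> real ^ 'n" where
  "vec_of c T = (\<chi> i. T c [i] [])"

text \<open>The vector with components a in the chart c, given in all other charts by the transformation law.
  Coordinate basis vectors are the case of unit vectors, and every tensor of type (1, 0) has this
  form; so vectors can be compared and transported through their components in one chart.\<close>

definition tangent ::
    "'m topology \<Rightarrow> ('m, 'n::finite) chart set \<Rightarrow> ('m, 'n) chart \<Rightarrow> real ^ 'n \<Rightarrow> ('m, 'n) tensor_field"
  where
  "tangent M \<A> c a x =
     (\<lambda>d ks ls. if d \<in> coords_at M \<A> x \<and> length ks = 1 \<and> ls = []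
                 then (jacobian c d x *v a) $ hd ks else 0)"

lemma sum_lists_length_1:
  fixes f :: "'a list \<Rightarrow> 'b::comm_monoid_add"
  shows "(\<Sum>us | length us = Suc 0. f us) = (\<Sum>k\<in>UNIV. f [k])"
proof -
  have "{us::'a list. length us = Suc 0} = (\<lambda>k. [k]) ` UNIV"
    by (auto simp: length_Suc_conv)
  moreover have "inj (\<lambda>k::'a. [k])" by (simp add: inj_on_def)
  ultimately show ?thesis by (simp add: sum.reindex del: length_Suc_conv)
qed

lemma tensors_1_0_iff:
  "T \<in> tensors M \<A> 1 0 x \<longleftrightarrow>
     (\<forall>c ks ls. \<not> (c \<in> coords_at M \<A> x \<and> length ks = 1 \<and> ls = []) \<longrightarrow> T c ks ls = 0) \<and>
     (\<forall>c\<in>coords_at M \<A> x. \<forall>d\<in>coords_at M \<A> x. vec_of d T = jacobian c d x *v vec_of c T)"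
proof -
  have "(\<forall>ks ls. length ks = 1 \<longrightarrow> length ls = 0 \<longrightarrow>
            T d ks ls =
              (\<Sum>us | length us = 1. \<Sum>vs | length vs = 0.
                 (\<Prod>a<1. jacobian c d x $ (ks ! a) $ (us ! a)) *
                 (\<Prod>b<0. jacobian d c x $ (vs ! b) $ (ls ! b)) * T c us vs))
        \<longleftrightarrow> vec_of d T = jacobian c d x *v vec_of c T" (is "?law c d \<longleftrightarrow> _") for c d
  proof -
    have "?law c d \<longleftrightarrow> (\<forall>ks. length ks = Suc 0 \<longrightarrow>
        T d ks [] = (\<Sum>k\<in>UNIV. jacobian c d x $ (ks ! 0) $ k * T c [k] []))"
      by (simp add: sum_lists_length_1)
    also have "\<dots> \<longleftrightarrow> (\<forall>i. T d [i] [] = (\<Sum>k\<in>UNIV. jacobian c d x $ i $ k * T c [k] []))"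
      by (auto simp: length_Suc_conv)
    finally show ?thesis
      by (simp add: vec_eq_iff vec_of_def matrix_vector_mult_def)
  qed
  then show ?thesis
    unfolding tensors_def by simp
qed

lemma vec_of_tangent:
  "d \<in> coords_at M \<A> x \<Longrightarrow> vec_of d (tangent M \<A> c a x) = jacobian c d x *v a"
  by (simp add: tangent_def vec_of_def vec_eq_iff)

lemma tangent_in_tensors:
  assumes A: "C2_manifold M \<A>" and c: "c \<in> coords_at M \<A> x"
  shows "tangent M \<A> c a x \<in> tensors M \<A> 1 0 x"
  unfolding tensors_1_0_iff
proof (intro conjI allI impI ballI)
  fix d e assume d: "d \<in> coords_at M \<A> x" and e: "e \<in> coords_at M \<A> x"
  show "vec_of e (tangent M \<A> c a x) = jacobian d e x *v vec_of d (tangent M \<A> c a x)"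
    using jacobian_chain[OF A c d e] by (simp add: vec_of_tangent d e matrix_vector_mul_assoc)
qed (auto simp: tangent_def)

lemma vec_of_tangent_self: "c \<in> coords_at M \<A> x \<Longrightarrow> vec_of c (tangent M \<A> c a x) = a"
  by (simp add: vec_of_tangent jacobian_self)

lemma coord_basis_eq_tangent: "coord_basis M \<A> c j = tangent M \<A> c (axis j 1)"
  by (simp add: fun_eq_iff coord_basis_def tangent_def matrix_vector_mult_basis column_def)

lemma vector_tensor_eqI:
  assumes S: "S \<in> tensors M \<A> 1 0 x" and T: "T \<in> tensors M \<A> 1 0 x"
    and c: "c \<in> coords_at M \<A> x" and eq: "vec_of c S = vec_of c T"
  shows "S = T"
proof (intro ext)
  fix d ks ls
  show "S d ks ls = T d ks ls"
  proof (cases "d \<in> coords_at M \<A> x \<and> length ks = 1 \<and> ls = []")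
    case True
    then obtain k where k: "ks = [k]" "ls = []" by (auto simp: length_Suc_conv)
    have "vec_of d S = jacobian c d x *v vec_of c S" "vec_of d T = jacobian c d x *v vec_of c T"
      using S T c True unfolding tensors_1_0_iff by blast+
    then have "vec_of d S = vec_of d T"
      by (simp only: eq)
    then show ?thesis
      by (auto simp: vec_of_def vec_eq_iff k)
  next
    case False
    then have "S d ks ls = 0" "T d ks ls = 0"
      using S T unfolding tensors_1_0_iff by blast+
    then show ?thesis by simp
  qed
qed

lemma tensor_add_scale_in_tensors:
  fixes S T :: "('m, 'n::finite) tensor"
  assumes S: "S \<in> tensors M \<A> 1 0 x" and T: "T \<in> tensors M \<A> 1 0 x"
  shows "tensor_add (tensor_scale r S) (tensor_scale s T) \<in> tensors M \<A> 1 0 x"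
proof -
  have *: "vec_of c (tensor_add (tensor_scale r S) (tensor_scale s T))
      = r *\<^sub>R vec_of c S + s *\<^sub>R vec_of c T" for c
    by (simp add: vec_of_def tensor_add_def tensor_scale_def vec_eq_iff)
  show ?thesis
    unfolding tensors_1_0_iff
  proof (intro conjI allI impI ballI)
    fix c and ks ls :: "'n list" assume "\<not> (c \<in> coords_at M \<A> x \<and> length ks = 1 \<and> ls = [])"
    then have "S c ks ls = 0" "T c ks ls = 0"
      using S T unfolding tensors_1_0_iff by blast+
    then show "tensor_add (tensor_scale r S) (tensor_scale s T) c ks ls = 0"
      by (simp add: tensor_add_def tensor_scale_def)
  next
    fix c d assume "c \<in> coords_at M \<A> x" "d \<in> coords_at M \<A> x"
    then have "vec_of d S = jacobian c d x *v vec_of c S" "vec_of d T = jacobian c d x *v vec_of c T"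
      using S T unfolding tensors_1_0_iff by blast+
    then show "vec_of d (tensor_add (tensor_scale r S) (tensor_scale s T))
        = jacobian c d x *v vec_of c (tensor_add (tensor_scale r S) (tensor_scale s T))"
      by (simp add: * matrix_vector_right_distrib matrix_vector_mult_scaleR)
  qed
qed

lemma vec_of_tensor_sum:
  "vec_of c (tensor_sum (\<lambda>i. tensor_scale (r i) (S i)) I) = (\<Sum>i\<in>I. r i *\<^sub>R vec_of c (S i))"
  by (simp add: vec_of_def tensor_sum_def tensor_scale_def vec_eq_iff)

lemma tensor_sum_in_tensors:
  assumes "finite I" "\<And>i. i \<in> I \<Longrightarrow> S i \<in> tensors M \<A> 1 0 x"
  shows "tensor_sum (\<lambda>i. tensor_scale (r i) (S i)) I \<in> tensors M \<A> 1 0 x"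
  using assms
proof (induction I rule: finite_induct)
  case empty
  then show ?case unfolding tensors_1_0_iff
    by (auto simp: tensor_sum_def vec_of_def vec_eq_iff matrix_vector_mult_def)
next
  case (insert i I)
  have "tensor_sum (\<lambda>i. tensor_scale (r i) (S i)) (insert i I)
    = tensor_add (tensor_scale (r i) (S i))
        (tensor_scale 1 (tensor_sum (\<lambda>i. tensor_scale (r i) (S i)) I))"
    using insert.hyps by (simp add: tensor_sum_def tensor_add_def tensor_scale_def)
  then show ?case
    using insert.IH insert.prems by (simp add: tensor_add_scale_in_tensors del: One_nat_def)
qed

lemma tangent_eq_tensor_sum:
  "tangent M \<A> c a x = tensor_sum (\<lambda>j. tensor_scale (a $ j) (coord_basis M \<A> c j x)) UNIV"
proof (intro ext)
  fix d ks ls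
  show "tangent M \<A> c a x d ks ls
      = tensor_sum (\<lambda>j. tensor_scale (a $ j) (coord_basis M \<A> c j x)) UNIV d ks ls"
  proof (cases "d \<in> coords_at M \<A> x \<and> length ks = 1 \<and> ls = []")
    case True
    then show ?thesis
      by (simp add: tensor_sum_def tensor_scale_def tangent_def coord_basis_def
        matrix_vector_mult_def mult.commute)
  next
    case False
    then have "coord_basis M \<A> c j x d ks ls = 0" for j
      unfolding coord_basis_def by (rule if_not_P)
    moreover have "tangent M \<A> c a x d ks ls = 0"
      unfolding tangent_def using False by (rule if_not_P)
    ultimately show ?thesis by (simp add: tensor_sum_def tensor_scale_def)
  qed
qed

lemma vector_tensor_eq_tangent:
  assumes A: "C2_manifold M \<A>" and c: "c \<in> coords_at M \<A> x" and T: "T \<in> tensors M \<A> 1 0 x"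
  shows "T = tangent M \<A> c (vec_of c T) x"
  by (rule vector_tensor_eqI[OF T tangent_in_tensors[OF A c] c]) (simp add: vec_of_tangent_self[OF c])

lemma tensor_sum_unit:
  fixes T :: "'n::finite \<Rightarrow> ('m, 'n) tensor"
  shows
  "tensor_sum (\<lambda>i. tensor_scale (mat 1 $ i $ j) (T i)) UNIV = T j"
proof -
  have "mat 1 $ i $ j * r = (if i = j then r else 0)" for i and r :: real
    by (simp add: mat_def)
  then show ?thesis by (simp add: tensor_sum_def tensor_scale_def)
qed

lemma vector_components_eq_vec_of: "vector_components V c x = vec_of c (V x)"
  by (simp add: vector_components_def vec_of_def)

lemma C1_vector_field_differentiable:
  assumes S: "C1_vector_field M \<A> S" and c: "c \<in> local_coords M \<A>" and u: "u \<in> chart_range c"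
  shows "(\<lambda>w. vector_components S c (chart_inv c w)) differentiable (at u)"
proof -
  have "(\<lambda>w. S (chart_inv c w) c [i] []) differentiable (at u)" for i
    using S c u unfolding C1_tensor_field_def by (blast intro: C1_on_imp_differentiable)
  then have "\<forall>b\<in>Basis. (\<lambda>w. vector_components S c (chart_inv c w) \<bullet> b) differentiable (at u)"
    by (auto simp: Basis_vec_def inner_axis vector_components_def)
  then show ?thesis
    using differentiable_componentwise_within by blast
qed

section \<open>The matrix of a flat transport\<close>

locale C1_flat_transport =
  fixes M :: "'m topology" and \<A> :: "('m, 'n::finite) chart set" and L :: "('m, 'n) transport"
  assumes manifold: "C2_manifold M \<A>"
    and flat: "flat_linear_transport M \<A> L"
    and C1: "C1_transport M \<A> L"
begin

text \<open>The hypothesis of class C1 asserts that some matrix function describes the transport and is of class C1,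
  so both properties have to be claimed of the same choice.  The first argument is the target point.\<close>

definition transport_mat :: "('m, 'n) chart \<Rightarrow> 'm \<Rightarrow> 'm \<Rightarrow> real ^ 'n ^ 'n" where
  "transport_mat c = (SOME H. transport_matrix L (chart_dom c) (coord_basis M \<A> c) H \<and>
     C1_on (chart_range c \<times> chart_range c) (\<lambda>(v, u). H (chart_inv c v) (chart_inv c u)))"

lemma transport_mat:
  assumes "c \<in> local_coords M \<A>"
  shows "transport_matrix L (chart_dom c) (coord_basis M \<A> c) (transport_mat c)"
    and "C1_on (chart_range c \<times> chart_range c)
      (\<lambda>(v, u). transport_mat c (chart_inv c v) (chart_inv c u))"
proof -
  have "\<exists>H. transport_matrix L (chart_dom c) (coord_basis M \<A> c) H \<and>
     C1_on (chart_range c \<times> chart_range c) (\<lambda>(v, u). H (chart_inv c v) (chart_inv c u))"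
    using C1 assms unfolding C1_transport_def by (rule bspec)
  from someI_ex[OF this]
  show "transport_matrix L (chart_dom c) (coord_basis M \<A> c) (transport_mat c)"
    and "C1_on (chart_range c \<times> chart_range c)
      (\<lambda>(v, u). transport_mat c (chart_inv c v) (chart_inv c u))"
    unfolding transport_mat_def by (rule conjunct1, rule conjunct2)
qed

lemma coords_atI: "c \<in> local_coords M \<A> \<Longrightarrow> x \<in> chart_dom c \<Longrightarrow> c \<in> coords_at M \<A> x"
  by (simp add: coords_at_def)

lemma coords_atD:
  assumes "c \<in> coords_at M \<A> x"
  shows "c \<in> local_coords M \<A>" "is_chart M c" "x \<in> chart_dom c" "x \<in> topspace M"
proof -
  show c: "c \<in> local_coords M \<A>" "is_chart M c" "x \<in> chart_dom c"
    using assms by (auto simp: coords_at_def local_coords_def)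
  show "x \<in> topspace M" using c openin_subset[OF is_chart_open_dom[OF c(2)]] by blast
qed

lemma coords_at_nonempty:
  assumes "x \<in> topspace M"
  shows "\<exists>c\<in>\<A>. c \<in> coords_at M \<A> x"
proof -
  have "(\<Union>c\<in>\<A>. chart_dom c) = topspace M"
    using manifold unfolding C2_manifold_def by blast
  then obtain c where c: "c \<in> \<A>" "x \<in> chart_dom c" using assms by blast
  then have "c \<in> coords_at M \<A> x"
    using atlas_subset_local_coords[OF manifold] by (intro coords_atI) auto
  with c(1) show ?thesis by blast
qed

lemma transport_in_tensors:
  "x \<in> topspace M \<Longrightarrow> y \<in> topspace M \<Longrightarrow> T \<in> tensors M \<A> p q x \<Longrightarrow> L x y T \<in> tensors M \<A> p q y"
  using flat[unfolded flat_linear_transport_def, THEN conjunct1] by blast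

lemma transport_linear:
  "x \<in> topspace M \<Longrightarrow> y \<in> topspace M \<Longrightarrow> S \<in> tensors M \<A> p q x \<Longrightarrow> T \<in> tensors M \<A> p q x \<Longrightarrow>
    L x y (tensor_add (tensor_scale r S) (tensor_scale s T)) =
      tensor_add (tensor_scale r (L x y S)) (tensor_scale s (L x y T))"
  using flat[unfolded flat_linear_transport_def, THEN conjunct2, THEN conjunct1] by blast

lemma transport_compose:
  "x \<in> topspace M \<Longrightarrow> y \<in> topspace M \<Longrightarrow> z \<in> topspace M \<Longrightarrow> T \<in> tensors M \<A> p q x \<Longrightarrow>
    L y z (L x y T) = L x z T"
  using flat[unfolded flat_linear_transport_def, THEN conjunct2, THEN conjunct2, THEN conjunct2, THEN conjunct2, THEN conjunct1] by blast

lemma transport_self: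
  "x \<in> topspace M \<Longrightarrow> T \<in> tensors M \<A> p q x \<Longrightarrow> L x x T = T"
  using flat[unfolded flat_linear_transport_def, THEN conjunct2, THEN conjunct2, THEN conjunct2, THEN conjunct2, THEN conjunct2] by blast

lemma transport_tensor_sum:
  assumes x: "x \<in> topspace M" and y: "y \<in> topspace M"
    and "finite I" "\<And>i. i \<in> I \<Longrightarrow> S i \<in> tensors M \<A> 1 0 x"
  shows "L x y (tensor_sum (\<lambda>i. tensor_scale (r i) (S i)) I)
    = tensor_sum (\<lambda>i. tensor_scale (r i) (L x y (S i))) I"
  using assms(3,4)
proof (induction I rule: finite_induct)
  case empty
  have "(\<lambda>c ks ls. 0) \<in> tensors M \<A> 1 0 x"
    using tensor_sum_in_tensors[of "{}" S M \<A> x r] by (simp add: tensor_sum_def)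
  from transport_linear[OF x y this this, of 0 0] show ?case
    by (simp add: tensor_sum_def tensor_add_def tensor_scale_def)
next
  case (insert i I)
  have *: "tensor_sum (\<lambda>i. tensor_scale (r i) (S i)) (insert i I)
    = tensor_add (tensor_scale (r i) (S i))
        (tensor_scale 1 (tensor_sum (\<lambda>i. tensor_scale (r i) (S i)) I))" for S
    using insert.hyps by (simp add: tensor_sum_def tensor_add_def tensor_scale_def)
  have "S i \<in> tensors M \<A> 1 0 x" "tensor_sum (\<lambda>i. tensor_scale (r i) (S i)) I \<in> tensors M \<A> 1 0 x"
    using insert.hyps insert.prems by (simp_all add: tensor_sum_in_tensors del: One_nat_def)
  from transport_linear[OF x y this, of "r i" 1] show ?case
    unfolding * using insert.IH insert.prems by (simp del: One_nat_def)
qed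

text \<open>The matrix is defined through the transport of basis vectors; linearity of the transport extends
  its action to all vectors of the tangent space.\<close>

lemma vec_of_transport:
  assumes c: "c \<in> local_coords M \<A>" and x: "x \<in> chart_dom c" and y: "y \<in> chart_dom c"
    and T: "T \<in> tensors M \<A> 1 0 x"
  shows "vec_of c (L x y T) = transport_mat c y x *v vec_of c T"
proof -
  have cx: "c \<in> coords_at M \<A> x" and cy: "c \<in> coords_at M \<A> y"
    using c x y by (auto intro: coords_atI)
  have xM: "x \<in> topspace M" and yM: "y \<in> topspace M"
    using coords_atD(4)[OF cx] coords_atD(4)[OF cy] by auto
  have E: "coord_basis M \<A> c j x \<in> tensors M \<A> 1 0 x" for j
    unfolding coord_basis_eq_tangent by (rule tangent_in_tensors[OF manifold cx])
  have col: "vec_of c (L x y (coord_basis M \<A> c j x)) $ i = transport_mat c y x $ i $ j" for i j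
  proof -
    have "L x y (coord_basis M \<A> c j x)
        = tensor_sum (\<lambda>i. tensor_scale (transport_mat c y x $ i $ j) (coord_basis M \<A> c i y)) UNIV"
      using transport_mat(1)[OF c] x y unfolding transport_matrix_def by blast
    then have "vec_of c (L x y (coord_basis M \<A> c j x))
        = (\<Sum>i\<in>UNIV. transport_mat c y x $ i $ j *\<^sub>R axis i 1)"
      by (simp add: vec_of_tensor_sum coord_basis_eq_tangent vec_of_tangent_self[OF cy])
    then show ?thesis
      by (simp add: axis_def if_distrib cong: if_cong)
  qed
  have "L x y T = L x y (tensor_sum (\<lambda>j. tensor_scale (vec_of c T $ j) (coord_basis M \<A> c j x)) UNIV)"
    using vector_tensor_eq_tangent[OF manifold cx T] by (simp add: tangent_eq_tensor_sum)
  also have "\<dots> = tensor_sum (\<lambda>j. tensor_scale (vec_of c T $ j) (L x y (coord_basis M \<A> c j x))) UNIV"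
    by (rule transport_tensor_sum[OF xM yM finite_class.finite_UNIV E])
  finally show ?thesis
    by (simp add: vec_of_tensor_sum vec_eq_iff matrix_vector_mult_def col mult.commute)
qed

lemma transport_mat_self:
  assumes c: "c \<in> local_coords M \<A>" and x: "x \<in> chart_dom c"
  shows "transport_mat c x x = mat 1"
proof -
  have cx: "c \<in> coords_at M \<A> x" using c x by (rule coords_atI)
  have "transport_mat c x x *v a = mat 1 *v a" for a
    using vec_of_transport[OF c x x tangent_in_tensors[OF manifold cx], of a]
      transport_self[OF coords_atD(4)[OF cx] tangent_in_tensors[OF manifold cx], of a]
    by (simp add: vec_of_tangent_self[OF cx])
  then show ?thesis by (simp add: matrix_eq)
qed

lemma transport_mat_compose:
  assumes c: "c \<in> local_coords M \<A>"
    and x: "x \<in> chart_dom c" and y: "y \<in> chart_dom c" and z: "z \<in> chart_dom c"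
  shows "transport_mat c z y ** transport_mat c y x = transport_mat c z x"
proof -
  have at: "c \<in> coords_at M \<A> w" "w \<in> topspace M" if "w \<in> chart_dom c" for w
    using coords_atI[OF c that] coords_atD by auto
  have "(transport_mat c z y ** transport_mat c y x) *v a = transport_mat c z x *v a" for a
  proof -
    have T: "tangent M \<A> c a x \<in> tensors M \<A> 1 0 x"
      by (rule tangent_in_tensors[OF manifold at(1)[OF x]])
    show ?thesis
      using transport_compose[OF at(2)[OF x] at(2)[OF y] at(2)[OF z] T]
        vec_of_transport[OF c y z transport_in_tensors[OF at(2)[OF x] at(2)[OF y] T]]
        vec_of_transport[OF c x y T] vec_of_transport[OF c x z T]
      by (simp add: vec_of_tangent_self[OF at(1)[OF x]] matrix_vector_mul_assoc)
  qed
  then show ?thesis by (simp add: matrix_eq)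
qed

lemma transport_mat_C1_source:
  assumes c: "c \<in> local_coords M \<A>" and y: "y \<in> chart_dom c"
  shows "C1_on (chart_range c) (\<lambda>u. transport_mat c y (chart_inv c u))"
proof -
  have "C1_on (chart_range c)
      ((\<lambda>(v, u). transport_mat c (chart_inv c v) (chart_inv c u)) \<circ> (\<lambda>u. (chart_map c y, u)))"
    using y by (intro C1_on_compose[OF C1_on_Pair_left transport_mat(2)[OF c]]) auto
  then show ?thesis
    by (simp add: o_def chart_inv_chart_map[OF local_coords_is_chart[OF c] y])
qed

lemma transport_mat_C1_target:
  assumes c: "c \<in> local_coords M \<A>" and x: "x \<in> chart_dom c"
  shows "C1_on (chart_range c) (\<lambda>v. transport_mat c (chart_inv c v) x)"
proof -
  have "C1_on (chart_range c)
      ((\<lambda>(v, u). transport_mat c (chart_inv c v) (chart_inv c u)) \<circ> (\<lambda>v. (v, chart_map c x)))"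
    using x by (intro C1_on_compose[OF C1_on_Pair_right transport_mat(2)[OF c]]) auto
  then show ?thesis
    by (simp add: o_def chart_inv_chart_map[OF local_coords_is_chart[OF c] x])
qed

text \<open>The connection coefficients: entry (i, j) of \<open>connection_mat c x v\<close> is \<open>\<Gamma>\<^sup>i\<^sub>j\<^sub>k v\<^sup>k\<close>,
  where \<open>\<Gamma>\<^sup>i\<^sub>j\<^sub>k\<close> is the derivative of the transport matrix with respect to the k-th coordinate of the
  source point, taken where source and target coincide.\<close>

definition connection_mat :: "('m, 'n) chart \<Rightarrow> 'm \<Rightarrow> real ^ 'n \<Rightarrow> real ^ 'n ^ 'n" where
  "connection_mat c x =
     frechet_derivative (\<lambda>w. transport_mat c x (chart_inv c w)) (at (chart_map c x))"

lemma transport_mat_has_derivative: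
  assumes c: "c \<in> local_coords M \<A>" and x: "x \<in> chart_dom c"
  shows "((\<lambda>w. transport_mat c x (chart_inv c w)) has_derivative connection_mat c x)
    (at (chart_map c x))"
  unfolding connection_mat_def
proof (rule iffD1[OF frechet_derivative_works])
  show "(\<lambda>w. transport_mat c x (chart_inv c w)) differentiable at (chart_map c x)"
    by (rule C1_on_imp_differentiable[OF transport_mat_C1_source[OF c x]]) (use x in blast)
qed

section \<open>The generated connection and its torsion\<close>

lemma eventually_displaced_in_range:
  assumes "c \<in> coords_at M \<A> x"
  shows "\<forall>\<^sub>F \<epsilon> in at 0. chart_map c x + \<epsilon> *\<^sub>R v \<in> chart_range c"
proof -
  have "((\<lambda>\<epsilon>. chart_map c x + \<epsilon> *\<^sub>R v) \<longlongrightarrow> chart_map c x + 0 *\<^sub>R v) (at (0::real))"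
    by (intro tendsto_intros)
  moreover have "open (chart_range c)" "chart_map c x \<in> chart_range c"
    using is_chart_open_range[OF coords_atD(2)[OF assms]] coords_atD(3)[OF assms] by auto
  ultimately show ?thesis
    using topological_tendstoD[of _ _ "at 0" "chart_range c"] by simp
qed

text \<open>The difference quotient that defines the connection is the one of \<open>\<epsilon> \<mapsto> K (u + \<epsilon> v) S (u + \<epsilon> v)\<close>
  at 0, where K is the transport matrix into x and u the coordinates of x.  As K is the identity
  at u, the product rule gives the familiar formula for the covariant derivative.\<close>

lemma generated_connection_components:
  assumes c: "c \<in> coords_at M \<A> x" and S: "C1_vector_field M \<A> S"
  shows "generated_connection M \<A> L V S x c [i] [] =
    (frechet_derivative (\<lambda>w. vector_components S c (chart_inv c w)) (at (chart_map c x))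
        (vector_components V c x)
      + connection_mat c x (vector_components V c x) *v vector_components S c x) $ i"
proof -
  note cc = coords_atD[OF c]
  define u where "u = chart_map c x"
  define v where "v = vector_components V c x"
  define s where "s w = vector_components S c (chart_inv c w)" for w
  define K where "K w = transport_mat c x (chart_inv c w)" for w
  have u: "u \<in> chart_range c" using cc(3) by (simp add: u_def)
  have inv_u: "chart_inv c u = x" using chart_inv_chart_map[OF cc(2,3)] by (simp add: u_def)
  have Ku: "K u = mat 1" by (simp add: K_def inv_u transport_mat_self[OF cc(1,3)])
  have "(s has_derivative frechet_derivative s (at u)) (at u)"
    unfolding s_def frechet_derivative_works[symmetric]
    by (rule C1_vector_field_differentiable[OF S cc(1) u])
  moreover have "(K has_derivative connection_mat c x) (at u)"
    unfolding K_def u_def by (rule transport_mat_has_derivative[OF cc(1,3)])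
  ultimately have D: "((\<lambda>w. K w *v s w) has_derivative
      (\<lambda>h. K u *v frechet_derivative s (at u) h + connection_mat c x h *v s u)) (at u)"
    by (intro bounded_bilinear.FDERIV[OF bounded_bilinear_matrix_vector_mult])
  define d where "d = K u *v frechet_derivative s (at u) v + connection_mat c x v *v s u"
  define g where "g \<epsilon> = K (u + \<epsilon> *\<^sub>R v) *v s (u + \<epsilon> *\<^sub>R v)" for \<epsilon> :: real
  have g0: "g 0 = s u" by (simp add: g_def Ku)
  have line: "((\<lambda>\<epsilon>. u + \<epsilon> *\<^sub>R v) has_derivative (\<lambda>\<epsilon>. \<epsilon> *\<^sub>R v)) (at 0)"
    by (auto intro!: derivative_eq_intros)
  have "(g has_derivative (\<lambda>\<epsilon>. K u *v frechet_derivative s (at u) (\<epsilon> *\<^sub>R v)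
      + connection_mat c x (\<epsilon> *\<^sub>R v) *v s u)) (at 0)"
    using has_derivative_compose[OF line, of "\<lambda>w. K w *v s w"] D unfolding g_def by simp
  moreover have "K u *v frechet_derivative s (at u) (\<epsilon> *\<^sub>R v) + connection_mat c x (\<epsilon> *\<^sub>R v) *v s u
      = \<epsilon> *\<^sub>R d" for \<epsilon>
    using linear_scale[OF has_derivative_linear[OF D], of \<epsilon> v] by (simp add: d_def)
  ultimately have "(g has_derivative (\<lambda>\<epsilon>. \<epsilon> *\<^sub>R d)) (at 0)" by simp
  then have "((\<lambda>\<epsilon>. g \<epsilon> $ i) has_derivative (\<lambda>\<epsilon>. (\<epsilon> *\<^sub>R d) $ i)) (at 0)"
    by (rule bounded_linear.has_derivative[OF bounded_linear_vec_nth])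
  then have "((\<lambda>\<epsilon>. g \<epsilon> $ i) has_real_derivative d $ i) (at 0)"
    unfolding has_field_derivative_def by (rule has_derivative_eq_rhs) (simp add: fun_eq_iff)
  then have "((\<lambda>\<epsilon>. (g \<epsilon> $ i - g 0 $ i) / \<epsilon>) \<longlongrightarrow> d $ i) (at 0)"
    by (simp add: DERIV_def)
  moreover have "\<forall>\<^sub>F \<epsilon> in at 0. (g \<epsilon> $ i - g 0 $ i) / \<epsilon> = tensor_scale (1 / \<epsilon>)
      (tensor_diff (L (displaced_point c V x \<epsilon>) x (S (displaced_point c V x \<epsilon>))) (S x)) c [i] []"
    using eventually_displaced_in_range[OF c, of v]
  proof eventually_elim
    case (elim \<epsilon>)
    have y: "chart_inv c (u + \<epsilon> *\<^sub>R v) \<in> chart_dom c"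
      using elim chart_inv_in_dom by (simp add: u_def)
    then have "S (chart_inv c (u + \<epsilon> *\<^sub>R v)) \<in> tensors M \<A> 1 0 (chart_inv c (u + \<epsilon> *\<^sub>R v))"
      using S coords_atD(4)[OF coords_atI[OF cc(1)]] unfolding C1_tensor_field_def by blast
    from vec_of_transport[OF cc(1) y cc(3) this]
    have "vec_of c (L (displaced_point c V x \<epsilon>) x (S (displaced_point c V x \<epsilon>))) = g \<epsilon>"
      by (simp add: displaced_point_def g_def K_def s_def v_def u_def vector_components_eq_vec_of)
    moreover have "vec_of c (S x) = g 0"
      by (simp add: g0 s_def inv_u vector_components_eq_vec_of)
    ultimately show ?case
      by (simp add: tensor_scale_def tensor_diff_def vec_of_def vec_eq_iff)
  qed
  ultimately have "((\<lambda>\<epsilon>. tensor_scale (1 / \<epsilon>)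
      (tensor_diff (L (displaced_point c V x \<epsilon>) x (S (displaced_point c V x \<epsilon>))) (S x)) c [i] [])
      \<longlongrightarrow> d $ i) (at 0)"
    by (rule Lim_transform_eventually)
  then have "generated_connection M \<A> L V S x c [i] [] = d $ i"
    using c by (simp add: generated_connection_def tendsto_Lim)
  also have "d = frechet_derivative s (at u) v + connection_mat c x v *v s u"
    by (simp add: d_def Ku)
  finally show ?thesis
    by (simp add: v_def s_def[abs_def] inv_u) (simp add: u_def)
qed

lemma generated_connection_eq_0:
  assumes S: "C1_vector_field M \<A> S"
    and no: "\<not> (c \<in> coords_at M \<A> x \<and> length ks = 1 \<and> ls = [])"
  shows "generated_connection M \<A> L V S x c ks ls = 0"
proof (cases "c \<in> coords_at M \<A> x")
  case True
  note cc = coords_atD[OF True]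
  have zero: "T c ks ls = 0" if "T \<in> tensors M \<A> 1 0 x" for T
    using that no unfolding tensors_1_0_iff by blast
  have "\<forall>\<^sub>F \<epsilon> in at 0. 0 = tensor_scale (1 / \<epsilon>)
      (tensor_diff (L (displaced_point c V x \<epsilon>) x (S (displaced_point c V x \<epsilon>))) (S x)) c ks ls"
    using eventually_displaced_in_range[OF True, of "vector_components V c x"]
  proof eventually_elim
    case (elim \<epsilon>)
    then have y: "displaced_point c V x \<epsilon> \<in> topspace M"
      unfolding displaced_point_def
      using coords_atD(4)[OF coords_atI[OF cc(1) chart_inv_in_dom]] by blast
    then have "S (displaced_point c V x \<epsilon>) \<in> tensors M \<A> 1 0 (displaced_point c V x \<epsilon>)"
        "S x \<in> tensors M \<A> 1 0 x"
      using S cc(4) unfolding C1_tensor_field_def by blast+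
    then have "L (displaced_point c V x \<epsilon>) x (S (displaced_point c V x \<epsilon>)) c ks ls = 0"
        "S x c ks ls = 0"
      using zero transport_in_tensors[OF y cc(4)] by blast+
    then show ?case
      by (simp add: tensor_scale_def tensor_diff_def)
  qed
  then have "((\<lambda>\<epsilon>. tensor_scale (1 / \<epsilon>)
      (tensor_diff (L (displaced_point c V x \<epsilon>) x (S (displaced_point c V x \<epsilon>))) (S x)) c ks ls)
      \<longlongrightarrow> 0) (at 0)"
    by (rule Lim_transform_eventually[OF tendsto_const])
  then show ?thesis
    using True by (simp add: generated_connection_def tendsto_Lim)
qed (simp add: generated_connection_def)

text \<open>The derivatives of the components of A and B cancel against those in the Lie bracket.\<close>

lemma torsion_components:
  assumes c: "c \<in> coords_at M \<A> x" and A: "C1_vector_field M \<A> A" and B: "C1_vector_field M \<A> B"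
  shows "torsion M \<A> (generated_connection M \<A> L) A B x c [i] [] =
    (connection_mat c x (vector_components A c x) *v vector_components B c x
      - connection_mat c x (vector_components B c x) *v vector_components A c x) $ i"
  using c
  by (simp add: torsion_def tensor_diff_def lie_bracket_def
      generated_connection_components[OF c A] generated_connection_components[OF c B])

lemma torsion_eq_0_iff:
  assumes A: "C1_vector_field M \<A> A" and B: "C1_vector_field M \<A> B"
  shows "torsion M \<A> (generated_connection M \<A> L) A B x = tensor_zero \<longleftrightarrow>
    (\<forall>c\<in>coords_at M \<A> x. connection_mat c x (vector_components A c x) *v vector_components B c x
      = connection_mat c x (vector_components B c x) *v vector_components A c x)" (is "?l \<longleftrightarrow> ?r")
proof
  assume ?l
  show ?r
  proof
    fix c assume c: "c \<in> coords_at M \<A> x"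
    show "connection_mat c x (vector_components A c x) *v vector_components B c x
      = connection_mat c x (vector_components B c x) *v vector_components A c x"
      using torsion_components[OF c A B] \<open>?l\<close> by (simp add: vec_eq_iff tensor_zero_def)
  qed
next
  assume r: ?r
  show ?l
  proof (intro ext)
    fix c and ks ls :: "'n list"
    show "torsion M \<A> (generated_connection M \<A> L) A B x c ks ls = tensor_zero c ks ls"
    proof (cases "c \<in> coords_at M \<A> x \<and> length ks = 1 \<and> ls = []")
      case True
      then obtain i where "ks = [i]" "ls = []" by (auto simp: length_Suc_conv)
      with True show ?thesis
        using torsion_components[OF _ A B, of c x i] r by (simp add: tensor_zero_def)
    next
      case False
      have "lie_bracket M \<A> A B x c ks ls = 0"
        unfolding lie_bracket_def using False by (rule if_not_P)
      then show ?thesis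
        using generated_connection_eq_0[OF A False] generated_connection_eq_0[OF B False]
        by (simp add: torsion_def tensor_diff_def tensor_zero_def)
    qed
  qed
qed

text \<open>In a chart with a chosen point y, flatness factors the transport from x through y.  The components
  of the field are therefore the transport matrix from y within the chart, applied to a constant
  vector, even if x lies outside of the chart.\<close>

lemma parallel_C1_vector_field:
  assumes x: "x \<in> topspace M" and T: "T \<in> tensors M \<A> 1 0 x"
  shows "C1_vector_field M \<A> (\<lambda>y. L x y T)"
  unfolding C1_tensor_field_def
proof (intro conjI ballI allI)
  show "L x y T \<in> tensors M \<A> 1 0 y" if "y \<in> topspace M" for y
    by (rule transport_in_tensors[OF x that T])
next
  fix c and ks ls :: "'n list" assume c: "c \<in> local_coords M \<A>"
  have op: "open (chart_range c)" using is_chart_open_range local_coords_is_chart[OF c] by blast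
  have inM: "chart_inv c u \<in> topspace M" if "u \<in> chart_range c" for u
    using coords_atD(4)[OF coords_atI[OF c chart_inv_in_dom[OF that]]] .
  show "C1_on (chart_range c) (\<lambda>u. L x (chart_inv c u) T c ks ls)"
  proof (cases "length ks = 1 \<and> ls = [] \<and> chart_dom c \<noteq> {}")
    case True
    then obtain i where i: "ks = [i]" "ls = []" by (auto simp: length_Suc_conv)
    obtain y where y: "y \<in> chart_dom c" using True by blast
    have yM: "y \<in> topspace M" using coords_atD(4)[OF coords_atI[OF c y]] .
    have Ty: "L x y T \<in> tensors M \<A> 1 0 y" by (rule transport_in_tensors[OF x yM T])
    have "bounded_linear (\<lambda>X::real ^ 'n ^ 'n. (X *v vec_of c (L x y T)) $ i)"
      by (rule bounded_linear_compose[OF bounded_linear_vec_nth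
            bounded_bilinear.bounded_linear_left[OF bounded_bilinear_matrix_vector_mult]])
    then have "C1_on UNIV (\<lambda>X::real ^ 'n ^ 'n. (X *v vec_of c (L x y T)) $ i)"
      by (rule C1_on_bounded_linear)
    from C1_on_compose[OF transport_mat_C1_target[OF c y] this]
    have "C1_on (chart_range c) (\<lambda>u. (transport_mat c (chart_inv c u) y *v vec_of c (L x y T)) $ i)"
      by (simp add: o_def)
    then show ?thesis
    proof (rule C1_on_cong_open[OF _ op order_refl])
      fix u assume u: "u \<in> chart_range c"
      show "(transport_mat c (chart_inv c u) y *v vec_of c (L x y T)) $ i
          = L x (chart_inv c u) T c ks ls"
        unfolding vec_of_transport[OF c y chart_inv_in_dom[OF u] Ty, symmetric]
          transport_compose[OF x yM inM[OF u] T]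
        by (simp add: i vec_of_def)
    qed
  next
    case False
    have "C1_on (chart_range c) (\<lambda>u. 0 :: real)"
      by (rule C1_on_bounded_linear[OF bounded_linear_zero])
    then show ?thesis
    proof (rule C1_on_cong_open[OF _ op order_refl])
      fix u assume u: "u \<in> chart_range c"
      then have "\<not> (length ks = 1 \<and> ls = [])" using False by blast
      then show "0 = L x (chart_inv c u) T c ks ls"
        using transport_in_tensors[OF x inM[OF u] T] unfolding tensors_1_0_iff by metis
    qed
  qed
qed

text \<open>The torsion at x depends on the values of the two fields at x only, and any two vectors at x are
  values of global vector fields of class C1: the transport L itself extends them, without any
  partition of unity.\<close>

lemma torsion_vanishes_iff:
  "torsion_vanishes M \<A> (generated_connection M \<A> L) \<longleftrightarrow>
    (\<forall>x. \<forall>c\<in>coords_at M \<A> x. \<forall>a b. connection_mat c x a *v b = connection_mat c x b *v a)"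
  (is "?l \<longleftrightarrow> ?r")
proof
  assume l: ?l
  show ?r
  proof (intro allI ballI)
    fix x c a b assume c: "c \<in> coords_at M \<A> x"
    note x = coords_atD(4)[OF c]
    define A where "A = (\<lambda>y. L x y (tangent M \<A> c a x))"
    define B where "B = (\<lambda>y. L x y (tangent M \<A> c b x))"
    note tan = tangent_in_tensors[OF manifold c]
    have AB: "C1_vector_field M \<A> A" "C1_vector_field M \<A> B"
      unfolding A_def B_def by (rule parallel_C1_vector_field[OF x tan])+
    have comp: "vector_components A c x = a" "vector_components B c x = b"
      unfolding vector_components_eq_vec_of A_def B_def transport_self[OF x tan]
      by (rule vec_of_tangent_self[OF c])+
    have "torsion M \<A> (generated_connection M \<A> L) A B x = tensor_zero"
      using l AB x unfolding torsion_vanishes_def by blast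
    then show "connection_mat c x a *v b = connection_mat c x b *v a"
      using c unfolding torsion_eq_0_iff[OF AB] comp[symmetric] by blast
  qed
next
  assume ?r
  then show ?l
    unfolding torsion_vanishes_def by (simp add: torsion_eq_0_iff)
qed

section \<open>Constant matrices and parallel coordinates\<close>

text \<open>A constant transport matrix is the identity, because \<open>L\<^bsub>x\<rightarrow>x\<^esub>\<close> is.  So the coordinate basis of the
  holonomic chart d is parallel, and in any chart c the transport matrix from y to x is the derivative
  of \<open>c \<circ> d\<^sup>-\<^sup>1\<close> at x times the derivative \<open>f'\<close> of \<open>d \<circ> c\<^sup>-\<^sup>1\<close> at y.  Differentiating in y shows
  that the connection coefficients are a second derivative, up to a linear map applied to it.\<close>

lemma constant_matrix_imp_symmetric:
  assumes U: "openin M U" "x \<in> U" and E: "holonomic_basis_field M \<A> U E"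
    and H: "transport_matrix L U E H"
    and const: "\<forall>x\<in>U. \<forall>y\<in>U. \<forall>x'\<in>U. \<forall>y'\<in>U. H y x = H y' x'"
    and c: "c \<in> coords_at M \<A> x"
  shows "connection_mat c x a *v b = connection_mat c x b *v a"
proof -
  note cc = coords_atD[OF c]
  obtain d where d: "d \<in> local_coords M \<A>" and Ud: "U \<subseteq> chart_dom d"
    and Ed: "\<And>y j. y \<in> U \<Longrightarrow> E j y = tangent M \<A> d (axis j 1) y"
    using E unfolding holonomic_basis_field_def coord_basis_eq_tangent by blast
  have at_d: "d \<in> coords_at M \<A> y" if "y \<in> U" for y
    using d Ud that by (auto intro: coords_atI)
  define Hx where "Hx = H x x"
  have Hyz: "H y z = Hx" if "y \<in> U" "z \<in> U" for y z
    using const that U(2) unfolding Hx_def by blast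
  have Hx: "Hx $ i $ j = mat 1 $ i $ j" for i j
  proof -
    have "L x x (E j x) = E j x"
      unfolding Ed[OF U(2)] by (rule transport_self[OF cc(4) tangent_in_tensors[OF manifold at_d[OF U(2)]]])
    moreover have "L x x (E j x) = tensor_sum (\<lambda>i. tensor_scale (Hx $ i $ j) (E i x)) UNIV"
      using H U(2) unfolding transport_matrix_def Hx_def by blast
    ultimately have "vec_of d (E j x) = vec_of d (tensor_sum (\<lambda>i. tensor_scale (Hx $ i $ j) (E i x)) UNIV)"
      by simp
    then have "axis j 1 = (\<Sum>i\<in>UNIV. Hx $ i $ j *\<^sub>R axis i (1::real))"
      by (simp add: vec_of_tensor_sum Ed[OF U(2)] vec_of_tangent_self[OF at_d[OF U(2)]])
    then have "axis j 1 $ i = (\<Sum>k\<in>UNIV. Hx $ k $ j *\<^sub>R axis k (1::real)) $ i" by simp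
    then show ?thesis
      by (simp add: axis_def mat_def if_distrib[of "(*) _"] eq_commute[of i j] cong: if_cong)
  qed
  have parallel: "L y z (E j y) = E j z" if y: "y \<in> U" and z: "z \<in> U" for y z j
  proof -
    have "L y z (E j y) = tensor_sum (\<lambda>i. tensor_scale (H z y $ i $ j) (E i z)) UNIV"
      using H y z unfolding transport_matrix_def by blast
    also have "\<dots> = tensor_sum (\<lambda>i. tensor_scale (mat 1 $ i $ j) (E i z)) UNIV"
      by (simp only: Hyz[OF z y] Hx)
    also have "\<dots> = E j z"
      by (rule tensor_sum_unit)
    finally show ?thesis .
  qed
  have frame: "transport_mat c x y *v b = jacobian d c x *v (jacobian c d y *v b)"
    if y: "y \<in> U" "y \<in> chart_dom c" for y b
  proof -
    have cy: "c \<in> coords_at M \<A> y" using coords_atI[OF cc(1) y(2)] .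
    have "(transport_mat c x y ** jacobian d c y) *v axis j 1 = jacobian d c x *v axis j 1" for j
      using vec_of_transport[OF cc(1) y(2) cc(3) tangent_in_tensors[OF manifold at_d[OF y(1)]], of "axis j 1"]
        parallel[OF y(1) U(2), of j]
      by (simp add: Ed y(1) U(2) vec_of_tangent[OF cy] vec_of_tangent[OF c] matrix_vector_mul_assoc)
    then have "transport_mat c x y ** jacobian d c y = jacobian d c x"
      by (simp add: matrix_vector_mult_basis column_def vec_eq_iff)
    moreover have "jacobian d c y ** jacobian c d y = mat 1"
      using jacobian_chain[OF manifold cy at_d[OF y(1)] cy] jacobian_self[OF cy] by simp
    ultimately show ?thesis
      by (metis matrix_mul_assoc matrix_mul_rid matrix_vector_mul_assoc)
  qed
  define N where "N = chart_map c ` (chart_dom c \<inter> U)"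
  have N: "open N" unfolding N_def
    by (rule open_chart_image[OF cc(2)]) (auto intro: openin_Int U(1) is_chart_open_dom cc(2))
  have uN: "chart_map c x \<in> N" using cc(3) U(2) by (simp add: N_def)
  have "C2_on N (chart_map d \<circ> chart_inv c)"
    by (rule C2_on_subset[OF transition_C2_on[OF manifold cc(1) d]]) (use Ud in \<open>auto simp: N_def\<close>)
  then obtain f' where f': "\<And>w. w \<in> N \<Longrightarrow>
      ((chart_map d \<circ> chart_inv c) has_derivative blinfun_apply (f' w)) (at w)"
    and C1f': "C1_on N f'"
    by (rule C2_onE) blast
  obtain f'' where f'': "(f' has_derivative f'') (at (chart_map c x))"
    using C1_on_imp_differentiable[OF C1f' uN] unfolding differentiable_def by blast
  have K: "transport_mat c x (chart_inv c w) *v b = jacobian d c x *v f' w b" if w: "w \<in> N" for w b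
  proof -
    obtain y where y: "y \<in> chart_dom c" "y \<in> U" "w = chart_map c y"
      using w unfolding N_def by blast
    have cy: "c \<in> coords_at M \<A> y" using coords_atI[OF cc(1) y(1)] .
    have "blinfun_apply (f' w) = (*v) (jacobian c d y)"
      using has_derivative_unique[OF f'[OF w]]
        transition_has_derivative_jacobian[OF manifold cy at_d[OF y(2)]] y(3) by blast
    then show ?thesis
      using frame[OF y(2,1)] y by (simp add: chart_inv_chart_map[OF cc(2)])
  qed
  have "connection_mat c x a *v b = jacobian d c x *v (f'' a b)" for a b
  proof -
    have "((\<lambda>w. transport_mat c x (chart_inv c w) *v b) has_derivative (\<lambda>a. connection_mat c x a *v b))
        (at (chart_map c x))"
      by (rule bounded_linear.has_derivative[OF bounded_bilinear.bounded_linear_left[OF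
            bounded_bilinear_matrix_vector_mult] transport_mat_has_derivative[OF cc(1,3)]])
    moreover have "((\<lambda>w. jacobian d c x *v f' w b) has_derivative (\<lambda>a. jacobian d c x *v f'' a b))
        (at (chart_map c x))"
      by (rule bounded_linear.has_derivative[OF matrix_vector_mul_bounded_linear
            bounded_linear.has_derivative[OF blinfun.bounded_linear_left f'']])
    then have "((\<lambda>w. transport_mat c x (chart_inv c w) *v b) has_derivative
        (\<lambda>a. jacobian d c x *v f'' a b)) (at (chart_map c x))"
      by (rule has_derivative_transform_within_open[OF _ N uN]) (simp add: K)
    ultimately show ?thesis by (metis has_derivative_unique)
  qed
  then show ?thesis
    using second_derivative_symmetric[OF N uN f' f''] by simp
qed

text \<open>For fixed z the columns of the transport matrix from z form a parallel frame F; its dual coframe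
  G is the transport matrix into z.  By flatness the derivative of G at x is the matrix
  from x to z times the connection coefficients at x, so their symmetry says that G is closed.  The
  coordinates that straighten F have the parallel fields F as their coordinate basis.\<close>

lemma symmetric_imp_parallel_chart:
  assumes sym: "\<And>x c a b. c \<in> coords_at M \<A> x \<Longrightarrow> connection_mat c x a *v b = connection_mat c x b *v a"
    and z: "z \<in> topspace M"
  obtains d where "d \<in> coords_at M \<A> z"
    "\<And>x y j. x \<in> chart_dom d \<Longrightarrow> y \<in> chart_dom d \<Longrightarrow>
      L x y (coord_basis M \<A> d j x) = coord_basis M \<A> d j y"
proof -
  obtain c where c: "c \<in> coords_at M \<A> z" using coords_at_nonempty[OF z] by blast
  note cc = coords_atD[OF c]
  interpret mv: bounded_bilinear "(*v) :: real ^ 'n ^ 'n \<Rightarrow> real ^ 'n \<Rightarrow> real ^ 'n"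
    by (rule bounded_bilinear_matrix_vector_mult)
  define F where "F w = mv.prod_right (transport_mat c (chart_inv c w) z)" for w
  define G where "G w = mv.prod_right (transport_mat c z (chart_inv c w))" for w
  define G' where "G' w a = mv.prod_right (transport_mat c z (chart_inv c w) ** connection_mat c (chart_inv c w) a)" for w a
  have C1prod: "C1_on UNIV mv.prod_right"
    by (rule C1_on_bounded_linear[OF mv.bounded_linear_prod_right])
  have C1F: "C1_on (chart_range c) F"
    using C1_on_compose[OF transport_mat_C1_target[OF cc(1,3)] C1prod] by (simp add: F_def[abs_def] o_def)
  have C1G: "C1_on (chart_range c) G"
    using C1_on_compose[OF transport_mat_C1_source[OF cc(1,3)] C1prod] by (simp add: G_def[abs_def] o_def)
  have FG: "F w o\<^sub>L G w = id_blinfun" and GF: "G w o\<^sub>L F w = id_blinfun"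
    if w: "w \<in> chart_range c" for w
    using transport_mat_compose[OF cc(1) cc(3) chart_inv_in_dom[OF w] cc(3)]
      transport_mat_compose[OF cc(1) chart_inv_in_dom[OF w] cc(3) chart_inv_in_dom[OF w]]
    by (auto intro!: blinfun_eqI simp: F_def G_def matrix_vector_mul_assoc
        transport_mat_self[OF cc(1,3)] transport_mat_self[OF cc(1) chart_inv_in_dom[OF w]])
  have G': "(G has_derivative G' w) (at w)" if w: "w \<in> chart_range c" for w
  proof -
    let ?x = "chart_inv c w"
    have x: "?x \<in> chart_dom c" by (rule chart_inv_in_dom[OF w])
    have "bounded_linear (\<lambda>X. transport_mat c z ?x ** X)"
      unfolding linear_conv_bounded_linear[symmetric]
      by (intro linearI)
        (simp_all add: vec_eq_iff matrix_matrix_mult_def sum.distrib sum_distrib_left algebra_simps)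
    from bounded_linear_compose[OF mv.bounded_linear_prod_right this]
    have "((\<lambda>v. mv.prod_right (transport_mat c z ?x ** transport_mat c ?x (chart_inv c v))) has_derivative G' w)
        (at (chart_map c ?x))"
      unfolding G'_def
      by (rule bounded_linear.has_derivative[OF _ transport_mat_has_derivative[OF cc(1) x]])
    then have "((\<lambda>v. mv.prod_right (transport_mat c z ?x ** transport_mat c ?x (chart_inv c v))) has_derivative G' w) (at w)"
      by (simp only: chart_map_chart_inv[OF w])
    then show ?thesis
    proof (rule has_derivative_transform_within_open[OF _ is_chart_open_range[OF cc(2)] w])
      show "mv.prod_right (transport_mat c z ?x ** transport_mat c ?x (chart_inv c v)) = G v"
        if "v \<in> chart_range c" for v
        using transport_mat_compose[OF cc(1) chart_inv_in_dom[OF that] x cc(3)] by (simp add: G_def)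
    qed
  qed
  have closed: "G' w a b = G' w b a" if w: "w \<in> chart_range c" for w a b
    using sym[OF coords_atI[OF cc(1) chart_inv_in_dom[OF w]], of a b]
    by (simp add: G'_def matrix_vector_mul_assoc[symmetric])
  have u0: "chart_map c z \<in> chart_range c" using cc(3) by blast
  obtain W V \<phi> \<psi> where W: "open W" "chart_map c z \<in> W" "W \<subseteq> chart_range c" and V: "open V"
    and hom: "homeomorphism W V \<phi> \<psi>" and \<phi>: "C2_on W \<phi>" and \<psi>: "C2_on V \<psi>"
    and der: "\<And>v. v \<in> V \<Longrightarrow> (\<psi> has_derivative blinfun_apply (F (\<psi> v))) (at v)"
    by (rule closed_coframe_coordinates[OF is_chart_open_range[OF cc(2)] u0 C1F C1G FG GF G' closed])
      blast+
  define d where "d = composed_chart c W \<phi>"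
  have d: "d \<in> local_coords M \<A>"
    unfolding d_def by (rule composed_chart_local_coords[OF manifold cc(1) W(1,3) V hom \<phi> \<psi>])
  note dc = composed_chart_is_chart[OF cc(2) W(1,3) V hom, folded d_def]
  have dom: "chart_dom d = {x \<in> chart_dom c. chart_map c x \<in> W}" and map: "chart_map d = \<phi> \<circ> chart_map c"
    by (simp_all add: d_def composed_chart_def)
  \<comment> \<open>The components in c of the coordinate basis of d are the columns of F.\<close>
  have jac: "jacobian d c x = transport_mat c x z" if x: "x \<in> chart_dom d" for x
  proof -
    have v: "chart_map d x \<in> V" using dc(2) x by blast
    have \<psi>x: "\<psi> (chart_map d x) = chart_map c x"
      using x hom by (simp add: dom map homeomorphism_def)
    have "(\<psi> has_derivative (*v) (transport_mat c x z)) (at (chart_map d x))"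
      using der[OF v] x by (simp add: \<psi>x F_def chart_inv_chart_map[OF cc(2)] dom)
    then have "((chart_map c \<circ> chart_inv d) has_derivative (*v) (transport_mat c x z)) (at (chart_map d x))"
    proof (rule has_derivative_transform_within_open[OF _ V v])
      show "\<psi> w = (chart_map c \<circ> chart_inv d) w" if w: "w \<in> V" for w
        using hom w W(3) chart_map_chart_inv[of "\<psi> w" c] by (auto simp: dc(3) homeomorphism_def)
    qed
    from frechet_derivative_at[OF this, symmetric] show ?thesis
      by (simp add: jacobian_def)
  qed
  have "L x y (coord_basis M \<A> d j x) = coord_basis M \<A> d j y"
    if x: "x \<in> chart_dom d" and y: "y \<in> chart_dom d" for x y j
  proof -
    have xc: "x \<in> chart_dom c" and yc: "y \<in> chart_dom c" using x y by (auto simp: dom)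
    note dx = coords_atI[OF d x] and dy = coords_atI[OF d y]
    note tx = tangent_in_tensors[OF manifold dx] and ty = tangent_in_tensors[OF manifold dy]
    show ?thesis
      unfolding coord_basis_eq_tangent
    proof (rule vector_tensor_eqI[OF _ ty coords_atI[OF cc(1) yc]])
      show "L x y (tangent M \<A> d (axis j 1) x) \<in> tensors M \<A> 1 0 y"
        by (rule transport_in_tensors[OF coords_atD(4)[OF dx] coords_atD(4)[OF dy] tx])
      show "vec_of c (L x y (tangent M \<A> d (axis j 1) x)) = vec_of c (tangent M \<A> d (axis j 1) y)"
        unfolding vec_of_transport[OF cc(1) xc yc tx] vec_of_tangent[OF coords_atI[OF cc(1) xc]]
          vec_of_tangent[OF coords_atI[OF cc(1) yc]] jac[OF x] jac[OF y] matrix_vector_mul_assoc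
          transport_mat_compose[OF cc(1,3) xc yc] ..
    qed
  qed
  moreover have "d \<in> coords_at M \<A> z"
    using coords_atI[OF d] cc(3) W(2) by (simp add: dom)
  ultimately show thesis using that by blast
qed

end

theorem corollary4p1:
  fixes M :: "'m topology"
    and \<A> :: "('m, 'n::finite) chart set"
    and L :: "('m, 'n) transport"
  assumes "C2_manifold M \<A>"
    and "flat_linear_transport M \<A> L"
    and "C1_transport M \<A> L"
  shows "torsion_vanishes M \<A> (generated_connection M \<A> L) \<longleftrightarrow>
    (\<forall>z\<in>topspace M. \<exists>U E H.
       openin M U \<and> z \<in> U \<and>
       holonomic_basis_field M \<A> U E \<and>
       transport_matrix L U E H \<and>
       (\<forall>x\<in>U. \<forall>y\<in>U. \<forall>x'\<in>U. \<forall>y'\<in>U. H y x = H y' x'))"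
proof -
  interpret C1_flat_transport M \<A> L
    using assms by (rule C1_flat_transport.intro)
  show ?thesis (is "?vanish \<longleftrightarrow> ?bases")
  proof
    assume ?vanish
    then have sym: "connection_mat c x a *v b = connection_mat c x b *v a"
      if "c \<in> coords_at M \<A> x" for x c a b
      using that unfolding torsion_vanishes_iff by blast
    show ?bases
    proof
      fix z assume "z \<in> topspace M"
      then obtain d where d: "d \<in> coords_at M \<A> z"
        and parallel: "\<And>x y j. x \<in> chart_dom d \<Longrightarrow> y \<in> chart_dom d \<Longrightarrow>
          L x y (coord_basis M \<A> d j x) = coord_basis M \<A> d j y"
        using symmetric_imp_parallel_chart[OF sym] by blast
      show "\<exists>U E H. openin M U \<and> z \<in> U \<and> holonomic_basis_field M \<A> U E \<and> transport_matrix L U E H \<and>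
          (\<forall>x\<in>U. \<forall>y\<in>U. \<forall>x'\<in>U. \<forall>y'\<in>U. H y x = H y' x')"
      proof (intro exI conjI)
        show "openin M (chart_dom d)" "z \<in> chart_dom d"
          using is_chart_open_dom[OF coords_atD(2)[OF d]] coords_atD(3)[OF d] by auto
        show "holonomic_basis_field M \<A> (chart_dom d) (coord_basis M \<A> d)"
          using coords_atD(1)[OF d] unfolding holonomic_basis_field_def by blast
        show "transport_matrix L (chart_dom d) (coord_basis M \<A> d) (\<lambda>_ _. mat 1)"
          unfolding transport_matrix_def tensor_sum_unit by (simp add: parallel)
      qed simp
    qed
  next
    assume bases: ?bases
    show ?vanish
      unfolding torsion_vanishes_iff
    proof (intro allI ballI)
      fix x c a b assume c: "c \<in> coords_at M \<A> x"
      obtain U E H where "openin M U \<and> x \<in> U \<and> holonomic_basis_field M \<A> U E \<and>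
          transport_matrix L U E H \<and> (\<forall>x\<in>U. \<forall>y\<in>U. \<forall>x'\<in>U. \<forall>y'\<in>U. H y x = H y' x')"
        using bspec[OF bases coords_atD(4)[OF c]] by (elim exE)
      then show "connection_mat c x a *v b = connection_mat c x b *v a"
        by (elim conjE) (rule constant_matrix_imp_symmetric[OF _ _ _ _ _ c])
    qed
  qed
qed

end
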